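(* Let $K$ be an infinite field, let $R=K[x_1,\dots,x_n]$, let $I\subsetneq R$ be a proper homogeneous ideal, and let $\operatorname{in}_\tau(I)$ be the initial ideal of $I$ with respect to a term order $\tau$. Then \[ r(R/I)\leq r(R/\operatorname{in}_\tau(I)). \]
   Context: $R=K[x_1,\dots,x_n]$ has the standard grading. A term order is a total order on the monomials of $R$ that is compatible with multiplication and has $1$ as its smallest element. The ideal $\operatorname{in}_\tau(I)$ is generated by the $\tau$-largest monomials of the nonzero elements of $I$. For a nonzero standard graded algebra $A$ (a quotient of $R$ by a proper homogeneous ideal) with homogeneous maximal ideal $\mathbf{m}$, a reduction of $\mathbf{m}$ is an ideal $J\subseteq\mathbf{m}$ with $J\mathbf{m}^k=\mathbf{m}^{k+1}$ for some $k\ge 0$, and a minimal reduction is a reduction that is minimal with respect to inclusion. The reduction number $r(A)$ is the least integer $k\geq 0$ such that there exists a minimal reduction $J$ of $\mathbf{m}$ with $J\mathbf{m}^k=\mathbf{m}^{k+1}$. Equivalently, $r(A)$ is the largest integer $k$ such that the Hilbert function of $A/J$ at $k$ does not vanish, where $J$ is the ideal of $A$ generated by $d=\dim A$ generic linear forms. *)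

theory Defs
  imports
    "HOL-Algebra.Algebra"
    "HOL-Algebra.Algebraic_Closure_Type"
    "HOL-Library.Poly_Mapping"
begin

text \<open>Exponent vectors of monomials, and polynomials as finitely supported coefficient functions;
  multiplication is the convolution product of \<^theory>\<open>HOL-Library.Poly_Mapping\<close>. The variables are
  indexed by a finite type, so their number is its cardinality.\<close>

type_synonym 'n monom = "'n \<Rightarrow>\<^sub>0 nat"

type_synonym ('n, 'k) mpoly = "('n \<Rightarrow>\<^sub>0 nat) \<Rightarrow>\<^sub>0 'k"

definition Var :: "'n \<Rightarrow> ('n, 'k::comm_ring_1) mpoly" where
  "Var i = Poly_Mapping.single (Poly_Mapping.single i 1) 1"

definition poly_ring :: "('n, 'k::comm_ring_1) mpoly ring" where
  "poly_ring = ring_of_type_algebra"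

definition monom_degree :: "'n::finite monom \<Rightarrow> nat" where
  "monom_degree s = (\<Sum>i\<in>UNIV. Poly_Mapping.lookup s i)"

definition hom_component :: "nat \<Rightarrow> ('n::finite, 'k::comm_ring_1) mpoly \<Rightarrow> ('n, 'k) mpoly" where
  "hom_component d f =
     (\<Sum>s\<in>{s \<in> Poly_Mapping.keys f. monom_degree s = d}.
        Poly_Mapping.single s (Poly_Mapping.lookup f s))"

definition homogeneous_ideal :: "('n::finite, 'k::comm_ring_1) mpoly set \<Rightarrow> bool" where
  "homogeneous_ideal I \<longleftrightarrow> ideal I poly_ring \<and> (\<forall>f\<in>I. \<forall>d. hom_component d f \<in> I)"

text \<open>An order is a reflexive relation; \<open>(s, t) \<in> \<tau>\<close> means that \<open>s\<close> is below or equal to \<open>t\<close>.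
  Multiplication of monomials is addition of exponent vectors, and the monomial 1 has exponent 0.\<close>

definition term_order :: "'n monom rel \<Rightarrow> bool" where
  "term_order \<tau> \<longleftrightarrow>
     linear_order \<tau> \<and>
     (\<forall>s t u. (s, t) \<in> \<tau> \<longrightarrow> (s + u, t + u) \<in> \<tau>) \<and>
     (\<forall>s. (0, s) \<in> \<tau>)"

definition is_leading_monom :: "'n monom rel \<Rightarrow> ('n, 'k::comm_ring_1) mpoly \<Rightarrow> 'n monom \<Rightarrow> bool" where
  "is_leading_monom \<tau> f s \<longleftrightarrow>
     s \<in> Poly_Mapping.keys f \<and> (\<forall>t\<in>Poly_Mapping.keys f. (t, s) \<in> \<tau>)"

definition initial_ideal ::
  "'n monom rel \<Rightarrow> ('n, 'k::comm_ring_1) mpoly set \<Rightarrow> ('n, 'k) mpoly set" where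
  "initial_ideal \<tau> I =
     Idl\<^bsub>poly_ring\<^esub> {Poly_Mapping.single s 1 | s. \<exists>f\<in>I. f \<noteq> 0 \<and> is_leading_monom \<tau> f s}"

text \<open>Powers of an ideal are taken in the monoid of ideals, so the 0th power is the whole ring.\<close>

definition reduction_at :: "('a, 'b) ring_scheme \<Rightarrow> 'a set \<Rightarrow> 'a set \<Rightarrow> nat \<Rightarrow> bool" where
  "reduction_at A m J k \<longleftrightarrow>
     ideal_prod A J (m [^]\<^bsub>ideals_set A\<^esub> k) = m [^]\<^bsub>ideals_set A\<^esub> Suc k"

definition reduction :: "('a, 'b) ring_scheme \<Rightarrow> 'a set \<Rightarrow> 'a set \<Rightarrow> bool" where
  "reduction A m J \<longleftrightarrow> ideal J A \<and> J \<subseteq> m \<and> (\<exists>k. reduction_at A m J k)"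

definition minimal_reduction :: "('a, 'b) ring_scheme \<Rightarrow> 'a set \<Rightarrow> 'a set \<Rightarrow> bool" where
  "minimal_reduction A m J \<longleftrightarrow>
     reduction A m J \<and> (\<forall>J'. reduction A m J' \<and> J' \<subseteq> J \<longrightarrow> J' = J)"

definition reduction_number :: "('a, 'b) ring_scheme \<Rightarrow> 'a set \<Rightarrow> nat" where
  "reduction_number A m = (LEAST k. \<exists>J. minimal_reduction A m J \<and> reduction_at A m J k)"

text \<open>The homogeneous maximal ideal of the quotient by \<open>I\<close>, generated by the classes of the
  variables.\<close>

definition quot_max_ideal ::
  "('n, 'k::comm_ring_1) mpoly set \<Rightarrow> ('n, 'k) mpoly set set" where
  "quot_max_ideal I = Idl\<^bsub>poly_ring Quot I\<^esub> {I +>\<^bsub>poly_ring\<^esub> Var i | i. True}"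

definition quot_reduction_number :: "('n, 'k::comm_ring_1) mpoly set \<Rightarrow> nat" where
  "quot_reduction_number I = reduction_number (poly_ring Quot I) (quot_max_ideal I)"

end

theory Submission
  imports Defs "Jordan_Normal_Form.Determinant"
begin

text \<open>
  Why the theorem is true. For an ideal \<open>I\<close> of \<open>R\<close> and a finite set \<open>W\<close> of linear forms, let \<open>W\<close>
  reduce \<open>I\<close> at \<open>k\<close> (\<open>lin_reduces\<close>) if \<open>I + (W)\<close> contains all monomials of degree \<open>k + 1\<close>; for
  homogeneous \<open>I\<close> this says that \<open>W\<close> generates a reduction of the maximal ideal of \<open>R/I\<close> with
  exponent \<open>k\<close>. The proof compares such sets for \<open>I\<close> and for its initial ideal \<open>U\<close>.

  Passing to linear forms. A minimal reduction \<open>L\<close> need not be homogeneous, but its space \<open>V\<close> of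
  linear parts reduces \<open>I\<close> at the same \<open>k\<close>. Some \<open>W \<subseteq> V\<close> of least size among the sets that reduce
  \<open>I\<close> somewhere already spans \<open>V\<close> modulo \<open>I\<close>: lifts of \<open>W\<close> to \<open>L\<close>, together with a high power of
  the maximal ideal, form a reduction inside \<open>L\<close>, hence all of \<open>L\<close>
  (\<open>minimal_reduction_imp_lin_reduces\<close>). Conversely, if \<open>W\<close> reduces \<open>I\<close> at \<open>k\<close> and no smaller set of
  linear forms reduces \<open>I\<close> at any exponent, then a graded version of Nakayama's lemma shows that
  \<open>I + (W)\<close> is a minimal reduction (\<open>lin_reduces_imp_minimal_reduction\<close>).

  Deformation. If \<open>W\<close> reduces \<open>U\<close> at \<open>k\<close>, then for a suitable point \<open>y\<close> of \<open>K^n\<close> the forms obtained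
  from \<open>W\<close> by the substitution \<open>x\<^sub>i \<mapsto> y\<^sub>i x\<^sub>i\<close> reduce \<open>I\<close> at \<open>k\<close> (\<open>lin_reduces_deformation\<close>). In
  degree \<open>k + 1\<close> choose a basis consisting of the monomials of \<open>U\<close> and of products of a form in \<open>W\<close>
  with a monomial. Replace each monomial \<open>s\<close> of \<open>U\<close> by an element of \<open>I\<close> with leading monomial \<open>s\<close>
  and rescale the products. The determinant of the new system is a polynomial in \<open>y\<close>. A permutation
  that contributes to it moves every \<open>s\<close> to a monomial that is not larger, so the contribution has
  the exponent of the identity only if every \<open>s\<close> is fixed; the coefficient of this one power of \<open>y\<close>
  is therefore the determinant of the original basis, which does not vanish. As \<open>K\<close> is infinite,
  some \<open>y\<close> works. Comparing exponents in this way replaces the usual choice of a weight vector.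

  Dimension. It remains to see that no fewer than \<open>card W\<close> linear forms reduce \<open>I\<close>, where \<open>W\<close> comes
  from a minimal reduction for \<open>U\<close>. By Noether normalisation \<open>W\<close> is algebraically independent
  modulo \<open>U\<close>, for a relation would give a smaller set in its span
  (\<open>algebraic_relation_imp_smaller\<close>). So there are at least \<open>(N + 1)^e\<close> monomials outside \<open>U\<close> of
  degree at most \<open>e N\<close>, where \<open>e = card W\<close>. These monomials are linearly independent modulo \<open>I\<close>, and
  if \<open>e'\<close> linear forms reduce \<open>I\<close> then they number at most \<open>C (e N + 1)^e'\<close>; hence \<open>e \<le> e'\<close>
  (\<open>card_independent_le_card_generators\<close>).
\<close>

section \<open>Polynomials, monomials and degrees\<close>

text \<open>
  Ideals are the submodules of the ring over itself, so \<open>idl.span S\<close> is the ideal generated by \<open>S\<close>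
  and \<open>idl.subspace\<close> expresses being an ideal. The prefix \<open>kv\<close> below is for the structure of a vector
  space over the coefficient field.
\<close>

global_interpretation idl: Modules.module "(*) :: 'a::comm_ring_1 \<Rightarrow> 'a \<Rightarrow> 'a"
  by unfold_locales (auto simp: algebra_simps)

(* This simp rule is associativity read from right to left and loops together with mult.assoc. *)
declare idl.scale_scale [simp del]

abbreviation xpow :: "'n monom \<Rightarrow> ('n, 'k::comm_ring_1) mpoly" where
  "xpow s \<equiv> Poly_Mapping.single s 1"

abbreviation cmul :: "'k::comm_ring_1 \<Rightarrow> ('n, 'k) mpoly \<Rightarrow> ('n, 'k) mpoly" where
  "cmul c p \<equiv> Poly_Mapping.single 0 c * p"

global_interpretation kv: Vector_Spaces.vector_space
    "\<lambda>c p. cmul c p :: ('n, 'k::field) mpoly"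
proof unfold_locales
  fix a b :: 'k and x y :: "('n, 'k) mpoly"
  show "cmul a (x + y) = cmul a x + cmul a y" by (simp add: algebra_simps)
  show "cmul (a + b) x = cmul a x + cmul b x" by (simp add: single_add algebra_simps)
  show "cmul a (cmul b x) = cmul (a * b) x" by (simp add: mult_single flip: mult.assoc)
  show "cmul 1 x = x" by simp
qed

declare kv.scale_scale [simp del]

lemma lookup_cmul [simp]: "Poly_Mapping.lookup (cmul c p) s = c * Poly_Mapping.lookup p s"
  by (simp flip: mult_map_scale_conv_mult add: map.rep_eq when_def)

lemma mpoly_expand: "p = (\<Sum>s\<in>Poly_Mapping.keys p. cmul (Poly_Mapping.lookup p s) (xpow s))"
  by (rule poly_mapping_eqI)
     (auto simp: lookup_sum lookup_single when_def in_keys_iff if_distrib[of "(*) _"] cong: if_cong)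

lemma xpow_mult: "xpow s * xpow t = (xpow (s + t) :: ('n, 'k::comm_ring_1) mpoly)"
  by (simp add: mult_single)

lemma lookup_mult_xpow: 
  fixes p :: "('n, 'k::comm_ring_1) mpoly"
  shows "Poly_Mapping.lookup (p * xpow a) (b + a) = Poly_Mapping.lookup p b"
proof -
  have "p * xpow a = (\<Sum>s\<in>Poly_Mapping.keys p. cmul (Poly_Mapping.lookup p s) (xpow (s + a)))"
    by (subst (1) mpoly_expand[of p]) (simp add: sum_distrib_right mult.assoc xpow_mult)
  then show ?thesis
    by (auto simp: lookup_sum lookup_single when_def in_keys_iff if_distrib[of "(*) _"] cong: if_cong)
qed

lemma lookup_mult_xpow_eq_0: 
  fixes p :: "('n, 'k::comm_ring_1) mpoly"
  assumes "\<And>b. v \<noteq> b + a"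
  shows "Poly_Mapping.lookup (p * xpow a) v = 0"
proof -
  have "p * xpow a = (\<Sum>s\<in>Poly_Mapping.keys p. cmul (Poly_Mapping.lookup p s) (xpow (s + a)))"
    by (subst (1) mpoly_expand[of p]) (simp add: sum_distrib_right mult.assoc xpow_mult)
  moreover have "s + a \<noteq> v" for s
    using assms[of s] by simp
  ultimately show ?thesis
    by (simp add: lookup_sum lookup_single when_def)
qed

lemma monom_degree_add [simp]: "monom_degree (s + t) = monom_degree s + monom_degree t"
  by (simp add: monom_degree_def lookup_add sum.distrib)

lemma monom_degree_zero [simp]: "monom_degree 0 = 0"
  by (simp add: monom_degree_def)

lemma monom_degree_eq_0 [simp]: "monom_degree s = 0 \<longleftrightarrow> s = 0"
proof
  assume "monom_degree s = 0"
  then have "Poly_Mapping.lookup s i = 0" for i by (simp add: monom_degree_def)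
  then show "s = 0" by (intro poly_mapping_eqI) simp
qed simp

lemma monom_degree_single [simp]: "monom_degree (Poly_Mapping.single i m) = m"
  by (simp add: monom_degree_def lookup_single when_def)

lemma finite_monom_degree_le: "finite {s :: 'n::finite monom. monom_degree s \<le> d}"
proof -
  have "Poly_Mapping.lookup ` {s :: 'n monom. monom_degree s \<le> d} \<subseteq> (\<Pi>\<^sub>E i\<in>UNIV. {..d})"
  proof clarify
    fix s :: "'n monom" assume "monom_degree s \<le> d"
    then have "Poly_Mapping.lookup s i \<le> d" for i
      using member_le_sum[of i UNIV "Poly_Mapping.lookup s"] by (simp add: monom_degree_def)
    then show "Poly_Mapping.lookup s \<in> (\<Pi>\<^sub>E i\<in>UNIV. {..d})" by auto
  qed
  then have "finite (Poly_Mapping.lookup ` {s :: 'n monom. monom_degree s \<le> d})"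
    by (rule finite_subset) (simp add: finite_PiE)
  then show ?thesis
    by (rule finite_imageD) (simp add: inj_on_def poly_mapping.lookup_inject)
qed

lemma finite_monom_degree_eq: "finite {s :: 'n::finite monom. monom_degree s = d}"
  by (rule finite_subset[OF _ finite_monom_degree_le[of d]]) (simp add: subset_iff)

lemma monom_split:
  "monom_degree s = a + b \<Longrightarrow> \<exists>s1 s2. s = s1 + s2 \<and> monom_degree s1 = a \<and> monom_degree s2 = b"
proof (induction a arbitrary: s b)
  case 0
  then show ?case by (intro exI[of _ 0] exI[of _ s]) simp
next
  case (Suc a)
  then obtain i where i: "Poly_Mapping.lookup s i > 0"
    by (metis Zero_neq_Suc add_Suc monom_degree_zero neq0_conv poly_mapping_eqI lookup_zero)
  define r where "r = s - Poly_Mapping.single i 1"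
  have s: "s = r + Poly_Mapping.single i 1"
    using i by (intro poly_mapping_eqI) (auto simp: r_def lookup_add lookup_minus lookup_single when_def)
  then have "monom_degree r = a + b" using Suc.prems by simp
  from Suc.IH[OF this] obtain s1 s2 where "r = s1 + s2" "monom_degree s1 = a" "monom_degree s2 = b"
    by blast
  then show ?case using s
    by (intro exI[of _ "s1 + Poly_Mapping.single i 1"] exI[of _ s2]) (simp add: ac_simps)
qed

lemma monom_degree_1E:
  assumes "monom_degree s = 1" obtains i where "s = Poly_Mapping.single i 1"
proof -
  obtain i where i: "Poly_Mapping.lookup s i > 0"
    using assms by (metis monom_degree_zero neq0_conv poly_mapping_eqI lookup_zero zero_neq_one)
  have s: "s = (s - Poly_Mapping.single i 1) + Poly_Mapping.single i 1"
    using i by (intro poly_mapping_eqI) (auto simp: lookup_add lookup_minus lookup_single when_def)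
  then have "monom_degree (s - Poly_Mapping.single i 1) = 0"
    using assms by (metis add_right_cancel add_0 monom_degree_add monom_degree_single)
  then have "s - Poly_Mapping.single i 1 = 0" by (simp only: monom_degree_eq_0)
  with s have "s = 0 + Poly_Mapping.single i 1" by metis
  then show thesis using that by simp
qed

definition homog :: "nat \<Rightarrow> ('n::finite, 'k::comm_ring_1) mpoly \<Rightarrow> bool" where
  "homog d p \<longleftrightarrow> (\<forall>s\<in>Poly_Mapping.keys p. monom_degree s = d)"

lemma lookup_hom_component [simp]:
  "Poly_Mapping.lookup (hom_component d p) s = (if monom_degree s = d then Poly_Mapping.lookup p s else 0)"
  by (auto simp: hom_component_def lookup_sum lookup_single when_def in_keys_iff)

lemma hom_component_zero [simp]: "hom_component d 0 = 0"
  by (rule poly_mapping_eqI) simp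

lemma hom_component_add: "hom_component d (p + q) = hom_component d p + hom_component d q"
  by (rule poly_mapping_eqI) (simp add: lookup_add)

lemma hom_component_cmul: "hom_component d (cmul c p) = cmul c (hom_component d p)"
  by (rule poly_mapping_eqI) simp

lemma hom_component_sum: "hom_component d (sum f A) = (\<Sum>x\<in>A. hom_component d (f x))"
  by (induction A rule: infinite_finite_induct) (simp_all add: hom_component_add)

lemma homog_altdef: "homog d p \<longleftrightarrow> (\<forall>s. monom_degree s \<noteq> d \<longrightarrow> Poly_Mapping.lookup p s = 0)"
  by (auto simp: homog_def in_keys_iff)

lemma homog_hom_component [simp]: "homog d (hom_component d p)"
  by (simp add: homog_altdef)

lemma hom_component_homog: "homog d p \<Longrightarrow> hom_component e p = (if d = e then p else 0)"
  by (intro poly_mapping_eqI) (auto simp: homog_altdef)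

lemma homog_xpow [simp]: "homog d (xpow s :: ('n::finite, 'k::comm_ring_1) mpoly) \<longleftrightarrow> monom_degree s = d"
  by (simp add: homog_def)

lemma homog_zero [simp]: "homog d 0"
  by (simp add: homog_def)

lemma homog_add: "homog d p \<Longrightarrow> homog d q \<Longrightarrow> homog d (p + q)"
  by (simp add: homog_altdef lookup_add)

lemma homog_cmul: "homog d p \<Longrightarrow> homog d (cmul c p)"
  by (simp add: homog_altdef)

lemma homog_sum: "(\<And>x. x \<in> A \<Longrightarrow> homog d (f x)) \<Longrightarrow> homog d (sum f A)"
  by (induction A rule: infinite_finite_induct) (simp_all add: homog_add)

lemma homog_mult: "homog d p \<Longrightarrow> homog e q \<Longrightarrow> homog (d + e) (p * q)"
  using keys_mult[of p q] unfolding homog_def by fastforce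

text \<open>
  This is the power of exponent \<open>d\<close> of the ideal generated by the variables.
\<close>

definition tail_ideal :: "nat \<Rightarrow> ('n::finite, 'k::comm_ring_1) mpoly set" where
  "tail_ideal d = {p. \<forall>s\<in>Poly_Mapping.keys p. d \<le> monom_degree s}"

lemma tail_ideal_altdef: "p \<in> tail_ideal d \<longleftrightarrow> (\<forall>s. monom_degree s < d \<longrightarrow> Poly_Mapping.lookup p s = 0)"
  by (auto simp: tail_ideal_def in_keys_iff not_le[symmetric])

lemma subspace_tail_ideal: "idl.subspace (tail_ideal d)"
proof (rule idl.subspaceI)
  fix c p :: "('a, 'b) mpoly" assume "p \<in> tail_ideal d"
  then show "c * p \<in> tail_ideal d" 
    using keys_mult[of c p] unfolding tail_ideal_def by fastforce
qed (auto simp: tail_ideal_altdef lookup_add)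

lemma tail_ideal_mult: "p \<in> tail_ideal d \<Longrightarrow> q \<in> tail_ideal e \<Longrightarrow> p * q \<in> tail_ideal (d + e)"
  using keys_mult[of p q] unfolding tail_ideal_def by fastforce

lemma tail_ideal_antimono: "d \<le> e \<Longrightarrow> tail_ideal e \<subseteq> tail_ideal d"
  by (auto simp: tail_ideal_def)

lemma xpow_in_tail_ideal [simp]:
  "(xpow s :: ('n::finite, 'k::comm_ring_1) mpoly) \<in> tail_ideal d \<longleftrightarrow> d \<le> monom_degree s"
  by (auto simp: tail_ideal_altdef lookup_single when_def not_le)

lemma tail_ideal_0 [simp]: "tail_ideal 0 = UNIV"
  by (auto simp: tail_ideal_def)

lemma homog_imp_tail_ideal: "homog d p \<Longrightarrow> p \<in> tail_ideal d"
  by (auto simp: homog_def tail_ideal_def)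

lemma subspace_idl_imp_kv: "idl.subspace S \<Longrightarrow> kv.subspace S"
  by (auto simp: idl.subspace_def kv.subspace_def)

lemma kv_span_subset_idl_span: "kv.span S \<subseteq> idl.span S"
  by (rule kv.span_minimal[OF idl.span_superset subspace_idl_imp_kv[OF idl.subspace_span]])

lemma in_subspace_if_monomials:
  assumes "kv.subspace Q" "\<And>s. s \<in> Poly_Mapping.keys p \<Longrightarrow> xpow s \<in> Q"
  shows "p \<in> Q"
proof -
  have "(\<Sum>s\<in>Poly_Mapping.keys p. cmul (Poly_Mapping.lookup p s) (xpow s)) \<in> Q"
    by (intro kv.subspace_sum[OF assms(1)] kv.subspace_scale[OF assms(1)] assms(2))
  then show ?thesis by (simp flip: mpoly_expand)
qed

text \<open>
  A monomial of degree at least \<open>d\<close> is a multiple of one of degree \<open>d\<close>.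
\<close>

lemma tail_ideal_subset:
  fixes Q :: "('n::finite, 'k::field) mpoly set"
  assumes Q: "idl.subspace Q" and "\<And>s. monom_degree s = d \<Longrightarrow> xpow s \<in> Q"
  shows "tail_ideal d \<subseteq> Q"
proof
  fix p :: "('n, 'k) mpoly" assume p: "p \<in> tail_ideal d"
  show "p \<in> Q"
  proof (rule in_subspace_if_monomials[OF subspace_idl_imp_kv[OF Q]])
    fix s assume "s \<in> Poly_Mapping.keys p"
    then have "monom_degree s = (monom_degree s - d) + d" using p by (auto simp: tail_ideal_def)
    then obtain s1 s2 where "s = s1 + s2" "monom_degree s2 = d"
      using monom_split[of s "monom_degree s - d" d] by blast
    then show "xpow s \<in> Q"
      using idl.subspace_scale[OF Q assms(2)[of s2], of "xpow s1"] by (simp add: xpow_mult)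
  qed
qed

lemma hom_component_mult_homog:
  assumes "homog a p"
  shows "hom_component d (c * p) = (if a \<le> d then hom_component (d - a) c * p else 0)"
proof -
  have E: "hom_component d (xpow s * p) = (if a \<le> d then hom_component (d - a) (xpow s) * p else 0)" for s
  proof -
    have "homog (monom_degree s + a) (xpow s * p)"
      using assms by (intro homog_mult) simp_all
    then have 1: "hom_component d (xpow s * p) = (if monom_degree s + a = d then xpow s * p else 0)"
      by (rule hom_component_homog)
    have "homog (monom_degree s) (xpow s :: ('a, 'b) mpoly)" by simp
    then have 2: "hom_component (d - a) (xpow s :: ('a, 'b) mpoly)
        = (if monom_degree s = d - a then xpow s else 0)"
      by (rule hom_component_homog)
    show ?thesis unfolding 1 2 by auto
  qed
  have expand: "c * q = (\<Sum>s\<in>Poly_Mapping.keys c. cmul (Poly_Mapping.lookup c s) (xpow s * q))" for q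
    by (subst (1) mpoly_expand[of c]) (simp only: sum_distrib_right mult.assoc)
  have "hom_component (d - a) c
      = (\<Sum>s\<in>Poly_Mapping.keys c. cmul (Poly_Mapping.lookup c s) (hom_component (d - a) (xpow s)))"
    by (subst (1) mpoly_expand[of c]) (simp only: hom_component_sum hom_component_cmul)
  then have "hom_component (d - a) c * p
      = (\<Sum>s\<in>Poly_Mapping.keys c. cmul (Poly_Mapping.lookup c s) (hom_component (d - a) (xpow s) * p))"
    by (simp only: sum_distrib_right mult.assoc)
  moreover have "hom_component d (c * p)
      = (\<Sum>s\<in>Poly_Mapping.keys c. cmul (Poly_Mapping.lookup c s)
          (if a \<le> d then hom_component (d - a) (xpow s) * p else 0))"
    by (simp only: expand[of p] hom_component_sum hom_component_cmul E)
  ultimately show ?thesis by simp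
qed

section \<open>Ideals of the quotient ring and their preimages\<close>

lemma poly_ring_simps [simp]:
  "carrier poly_ring = UNIV" "x \<otimes>\<^bsub>poly_ring\<^esub> y = x * y" "x \<oplus>\<^bsub>poly_ring\<^esub> y = x + y"
  "\<one>\<^bsub>poly_ring\<^esub> = 1" "\<zero>\<^bsub>poly_ring\<^esub> = 0"
  by (simp_all add: poly_ring_def ring_of_type_algebra_def)

lemma cring_poly_ring: "cring (poly_ring :: ('n, 'k::comm_ring_1) mpoly ring)"
  unfolding poly_ring_def by (rule cring_from_type_algebra)

lemma ideal_poly_ring_iff:
  fixes I :: "('n, 'k::comm_ring_1) mpoly set"
  shows "ideal I poly_ring \<longleftrightarrow> idl.subspace I"
proof
  assume "ideal I poly_ring"
  then interpret ideal I poly_ring .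
  show "idl.subspace I"
    using additive_subgroup.zero_closed[OF is_additive_subgroup]
      additive_subgroup.a_closed[OF is_additive_subgroup] I_l_closed
    by (intro idl.subspaceI) auto
next
  assume I: "idl.subspace I"
  interpret cring "poly_ring :: ('n, 'k) mpoly ring" by (rule cring_poly_ring)
  have neg: "\<ominus>\<^bsub>poly_ring\<^esub> x = - x" for x :: "('n, 'k) mpoly"
    by (rule minus_equality) simp_all
  show "ideal I poly_ring"
  proof (rule idealI)
    show "ring (poly_ring :: ('n, 'k) mpoly ring)" by (rule ring_axioms)
    show "subgroup I (add_monoid poly_ring)"
    proof (rule add.subgroupI)
      show "I \<noteq> {}" using idl.subspace_0[OF I] by auto
      show "\<ominus>\<^bsub>poly_ring\<^esub> a \<in> I" if "a \<in> I" for a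
        using idl.subspace_neg[OF I that] by (simp add: neg)
    qed (use idl.subspace_add[OF I] in auto)
  qed (use idl.subspace_scale[OF I] in \<open>simp_all add: mult.commute\<close>)
qed

lemma genideal_poly_ring:
  fixes S :: "('n, 'k::comm_ring_1) mpoly set"
  shows "Idl\<^bsub>poly_ring\<^esub> S = idl.span S"
  by (simp add: genideal_def idl.span_def hull_def ideal_poly_ring_iff)

text \<open>
  Ideals \<open>J\<close> of \<open>R/I\<close> are studied through their preimages \<open>lift J\<close> in \<open>R\<close>, which are the ideals of
  \<open>R\<close> that contain \<open>I\<close>; the inverse passage is the image under \<open>cls\<close>.
\<close>

locale poly_quotient =
  fixes I :: "('n::finite, 'k::field) mpoly set"
  assumes I: "idl.subspace I"
begin

abbreviation "A \<equiv> poly_ring Quot I"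

definition cls :: "('n, 'k) mpoly \<Rightarrow> ('n, 'k) mpoly set" where
  "cls f = I +>\<^bsub>poly_ring\<^esub> f"

definition lift :: "('n, 'k) mpoly set set \<Rightarrow> ('n, 'k) mpoly set" where
  "lift J = {f. cls f \<in> J}"

lemma ideal_I: "ideal I poly_ring"
  using I by (simp add: ideal_poly_ring_iff)

lemma cring_A: "cring A"
  by (rule ideal.quotient_is_cring[OF ideal_I cring_poly_ring])

lemma cls_altdef: "cls f = {i + f | i. i \<in> I}"
  by (auto simp: cls_def a_r_coset_def r_coset_def)

lemma cls_eq_iff: "cls f = cls g \<longleftrightarrow> f - g \<in> I"
proof
  assume "cls f = cls g"
  moreover have "f \<in> cls f" using idl.subspace_0[OF I] by (force simp: cls_altdef)
  ultimately show "f - g \<in> I" by (auto simp: cls_altdef)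
next
  assume *: "f - g \<in> I"
  have "cls f' \<subseteq> cls g'" if "f' - g' \<in> I" for f' g'
  proof
    fix x assume "x \<in> cls f'"
    then obtain i where "i \<in> I" "x = i + f'" by (auto simp: cls_altdef)
    then have "x = (i + (f' - g')) + g'" "i + (f' - g') \<in> I"
      using idl.subspace_add[OF I _ that] by auto
    then show "x \<in> cls g'" unfolding cls_altdef by blast
  qed
  from this[OF *] this[of g f] idl.subspace_neg[OF I *] show "cls f = cls g" by auto
qed

lemma A_simps:
  "carrier A = range cls" "cls f \<otimes>\<^bsub>A\<^esub> cls g = cls (f * g)" "cls f \<oplus>\<^bsub>A\<^esub> cls g = cls (f + g)"
  "\<one>\<^bsub>A\<^esub> = cls 1" "\<zero>\<^bsub>A\<^esub> = cls 0"
proof -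
  interpret ideal I poly_ring by (rule ideal_I)
  note hom = rcos_ring_hom
  show "carrier A = range cls"
    by (auto simp: FactRing_def A_RCOSETS_defs cls_def a_r_coset_def)
  show "cls f \<otimes>\<^bsub>A\<^esub> cls g = cls (f * g)"
    using ring_hom_mult[OF hom, of f g] by (simp add: cls_def)
  show "cls f \<oplus>\<^bsub>A\<^esub> cls g = cls (f + g)"
    using ring_hom_add[OF hom, of f g] by (simp add: cls_def)
  show "\<one>\<^bsub>A\<^esub> = cls 1"
    using ring_hom_one[OF hom] by (simp add: cls_def)
  have "\<zero>\<^bsub>A\<^esub> = I" by (simp add: FactRing_def)
  also have "I = cls 0" by (auto simp: cls_altdef)
  finally show "\<zero>\<^bsub>A\<^esub> = cls 0" .
qed

lemma mem_lift: "f \<in> lift J \<longleftrightarrow> cls f \<in> J"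
  by (simp add: lift_def)

lemma subspace_lift:
  assumes "ideal J A" shows "idl.subspace (lift J)"
proof -
  interpret ideal J A by fact
  show ?thesis
  proof (rule idl.subspaceI)
    show "0 \<in> lift J" using additive_subgroup.zero_closed[OF is_additive_subgroup]
      by (simp add: mem_lift A_simps)
    show "f + g \<in> lift J" if "f \<in> lift J" "g \<in> lift J" for f g
      using that additive_subgroup.a_closed[OF is_additive_subgroup, of "cls f" "cls g"] by (simp add: mem_lift A_simps)
    show "c * f \<in> lift J" if "f \<in> lift J" for c f
      using that I_l_closed[of "cls f" "cls c"] by (simp add: mem_lift A_simps)
  qed
qed

lemma subset_lift:
  assumes "ideal J A" shows "I \<subseteq> lift J"
proof
  fix f assume "f \<in> I"
  then have "cls f = cls 0" by (simp add: cls_eq_iff)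
  moreover have "0 \<in> lift J" using idl.subspace_0[OF subspace_lift[OF assms]] .
  ultimately show "f \<in> lift J" by (simp add: mem_lift)
qed

lemma ideal_subset_range:
  assumes "ideal J A" shows "J \<subseteq> range cls"
  using additive_subgroup.a_subset[OF ideal.axioms(1)[OF assms]] by (simp add: A_simps)

lemma image_lift:
  assumes "ideal J A" shows "cls ` lift J = J"
  using ideal_subset_range[OF assms] by (auto simp: lift_def)

lemma lift_image:
  assumes "idl.subspace L" "I \<subseteq> L" shows "lift (cls ` L) = L"
proof -
  have "f \<in> L" if "g \<in> L" "cls f = cls g" for f g
    using idl.subspace_add[OF assms(1), of "f - g" g] that assms(2) by (auto simp: cls_eq_iff)
  then show ?thesis by (auto simp: lift_def)
qed

lemma ideal_image:
  assumes L: "idl.subspace L" shows "ideal (cls ` L) A"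
proof -
  interpret cring A by (rule cring_A)
  have neg: "\<ominus>\<^bsub>A\<^esub> cls f = cls (- f)" for f
    by (rule minus_equality) (simp_all add: A_simps)
  show ?thesis
  proof (rule idealI)
    show "ring A" by (rule ring_axioms)
    show "subgroup (cls ` L) (add_monoid A)"
    proof (rule add.subgroupI)
      show "cls ` L \<subseteq> carrier A" by (auto simp: A_simps)
      show "cls ` L \<noteq> {}" using idl.subspace_0[OF L] by auto
      show "\<ominus>\<^bsub>A\<^esub> a \<in> cls ` L" if "a \<in> cls ` L" for a
        using idl.subspace_neg[OF L] that by (auto simp: neg)
      show "a \<oplus>\<^bsub>A\<^esub> b \<in> cls ` L" if "a \<in> cls ` L" "b \<in> cls ` L" for a b
        using idl.subspace_add[OF L] that by (auto simp: A_simps)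
    qed
    show "x \<otimes>\<^bsub>A\<^esub> a \<in> cls ` L" if "a \<in> cls ` L" "x \<in> carrier A" for a x
      using idl.subspace_scale[OF L] that by (auto simp: A_simps)
    show "a \<otimes>\<^bsub>A\<^esub> x \<in> cls ` L" if "a \<in> cls ` L" "x \<in> carrier A" for a x
      using idl.subspace_scale[OF L] that by (auto simp: A_simps mult.commute)
  qed
qed

lemma lift_subset_iff:
  assumes "ideal J A" "ideal J' A" shows "lift J \<subseteq> lift J' \<longleftrightarrow> J \<subseteq> J'"
proof
  assume "lift J \<subseteq> lift J'"
  then have "cls ` lift J \<subseteq> cls ` lift J'" by (rule image_mono)
  then show "J \<subseteq> J'" by (simp only: image_lift assms)
qed (auto simp: lift_def)

lemma lift_eq_iff:
  assumes "ideal J A" "ideal J' A" shows "lift J = lift J' \<longleftrightarrow> J = J'"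
  using lift_subset_iff[OF assms] lift_subset_iff[OF assms(2,1)] by (simp only: set_eq_subset)

text \<open>
  The preimage of a product contains \<open>I\<close>, whereas the product of the preimages need not; this is why
  \<open>I\<close> is adjoined to the generators.
\<close>

lemma lift_ideal_prod:
  assumes J: "ideal J A" and K: "ideal K A"
  shows "lift (ideal_prod A J K) = idl.span (I \<union> {f * g | f g. f \<in> lift J \<and> g \<in> lift K})"
    (is "_ = ?S")
proof
  interpret cring A by (rule cring_A)
  have JK: "ideal (ideal_prod A J K) A" by (rule ideal_prod_is_ideal[OF J K])
  have "cls (f * g) \<in> ideal_prod A J K" if "cls f \<in> J" "cls g \<in> K" for f g
    using ideal_prod.prod[OF that, of A] by (simp add: A_simps)
  then have "I \<union> {f * g | f g. f \<in> lift J \<and> g \<in> lift K} \<subseteq> lift (ideal_prod A J K)"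
    using subset_lift[OF JK] by (auto simp: mem_lift)
  then show "?S \<subseteq> lift (ideal_prod A J K)"
    by (rule idl.span_minimal) (rule subspace_lift[OF JK])
  have "x \<in> cls ` ?S" if "x \<in> ideal_prod A J K" for x
    using that
  proof induction
    case (prod i j)
    then have "i \<in> cls ` lift J" "j \<in> cls ` lift K"
      by (simp_all only: image_lift J K)
    then obtain f g where "i = cls f" "j = cls g" "f \<in> lift J" "g \<in> lift K" by blast
    then have *: "i \<otimes>\<^bsub>A\<^esub> j = cls (f * g)" "f * g \<in> I \<union> {f * g | f g. f \<in> lift J \<and> g \<in> lift K}"
      by (simp add: A_simps, blast)
    show ?case unfolding *(1) by (intro imageI idl.span_base *(2))
  next
    case (sum s1 s2)
    then obtain f g where "s1 = cls f" "s2 = cls g" "f \<in> ?S" "g \<in> ?S" by blast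
    then have *: "s1 \<oplus>\<^bsub>A\<^esub> s2 = cls (f + g)" "f + g \<in> ?S"
      by (simp only: A_simps, intro idl.span_add)
    show ?case unfolding *(1) by (intro imageI *(2))
  qed
  then have "lift (ideal_prod A J K) \<subseteq> lift (cls ` ?S)"
    unfolding lift_def by (intro Collect_mono impI)
  moreover have "lift (cls ` ?S) = ?S"
  proof (rule lift_image)
    show "I \<subseteq> ?S" using idl.span_superset by blast
  qed simp
  ultimately show "lift (ideal_prod A J K) \<subseteq> ?S" by simp
qed

abbreviation "m \<equiv> quot_max_ideal I"

end

definition monomial_multiples :: "('n::finite, 'k::comm_ring_1) mpoly set \<Rightarrow> nat \<Rightarrow> ('n, 'k) mpoly set" where
  "monomial_multiples L d = {f * xpow t | f t. f \<in> L \<and> monom_degree t = d}"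

text \<open>
  The condition \<open>J m^k = m^(k+1)\<close> for an ideal \<open>J \<subseteq> m\<close> of \<open>R/I\<close>, written in terms of the preimage \<open>L\<close>
  of \<open>J\<close>. Only one inclusion is required, and only on monomials, because the other one holds
  for \<open>J \<subseteq> m\<close>; see \<open>reduction_at_iff\<close> below.
\<close>

definition reduces_at ::
  "('n::finite, 'k::comm_ring_1) mpoly set \<Rightarrow> ('n, 'k) mpoly set \<Rightarrow> nat \<Rightarrow> bool" where
  "reduces_at I L k \<longleftrightarrow> (\<forall>s. monom_degree s = Suc k \<longrightarrow> xpow s \<in> idl.span (I \<union> monomial_multiples L k))"

definition is_reduction ::
  "('n::finite, 'k::comm_ring_1) mpoly set \<Rightarrow> ('n, 'k) mpoly set \<Rightarrow> bool" where
  "is_reduction I L \<longleftrightarrow> idl.subspace L \<and> I \<subseteq> L \<and> L \<subseteq> tail_ideal 1 \<and> (\<exists>k. reduces_at I L k)"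

definition is_minimal_reduction ::
  "('n::finite, 'k::comm_ring_1) mpoly set \<Rightarrow> ('n, 'k) mpoly set \<Rightarrow> bool" where
  "is_minimal_reduction I L \<longleftrightarrow>
     is_reduction I L \<and> (\<forall>L'. is_reduction I L' \<and> L' \<subseteq> L \<longrightarrow> L' = L)"

locale proper_poly_quotient = poly_quotient I for I :: "('n::finite, 'k::field) mpoly set" +
  assumes I_subset: "I \<subseteq> tail_ideal 1"
begin

lemma m_eq: "m = cls ` tail_ideal 1"
proof -
  interpret cring A by (rule cring_A)
  let ?V = "{I +>\<^bsub>poly_ring\<^esub> Var i | i. True}"
  have V: "?V = range (\<lambda>i. cls (xpow (Poly_Mapping.single i 1)))"
    by (auto simp: cls_def Var_def)
  have "?V \<subseteq> cls ` tail_ideal 1" unfolding V by auto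
  then have 1: "m \<subseteq> cls ` tail_ideal 1"
    unfolding quot_max_ideal_def by (rule genideal_minimal[OF ideal_image[OF subspace_tail_ideal]])
  have "?V \<subseteq> carrier A" unfolding V by (auto simp: A_simps)
  from genideal_ideal[OF this] genideal_self[OF this]
  have id: "ideal m A" and V': "?V \<subseteq> m" unfolding quot_max_ideal_def by auto
  have "tail_ideal 1 \<subseteq> lift m"
  proof (rule tail_ideal_subset[OF subspace_lift[OF id]])
    fix s :: "'n monom" assume "monom_degree s = 1"
    then obtain i where "s = Poly_Mapping.single i 1" by (rule monom_degree_1E)
    then show "xpow s \<in> lift m" using V' unfolding V by (auto simp: mem_lift)
  qed
  with 1 show ?thesis by (auto simp: mem_lift)
qed

lemma ideal_m: "ideal m A"
  unfolding m_eq by (rule ideal_image[OF subspace_tail_ideal])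

lemma lift_m: "lift m = tail_ideal 1"
  unfolding m_eq by (rule lift_image[OF subspace_tail_ideal I_subset])

lemma m_pow: "ideal (m [^]\<^bsub>ideals_set A\<^esub> k) A \<and>
    lift (m [^]\<^bsub>ideals_set A\<^esub> k) = idl.span (I \<union> tail_ideal k)"
proof (induction k)
  interpret cring A by (rule cring_A)
  case 0
  have "m [^]\<^bsub>ideals_set A\<^esub> (0::nat) = carrier A"
    by (simp add: nat_pow_def ideals_set_def)
  then show ?case using oneideal by (simp add: lift_def A_simps)
next
  interpret cring A by (rule cring_A)
  case (Suc k)
  have pow: "m [^]\<^bsub>ideals_set A\<^esub> Suc k = ideal_prod A (m [^]\<^bsub>ideals_set A\<^esub> k) m"
    by (simp add: nat_pow_def ideals_set_def)
  have eq: "idl.span (I \<union> {f * g | f g. f \<in> idl.span (I \<union> tail_ideal k) \<and> g \<in> tail_ideal 1})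
      = idl.span (I \<union> tail_ideal (Suc k))" (is "idl.span ?L = idl.span ?R")
  proof (rule equalityI)
    have "f * g \<in> idl.span ?R" if f: "f \<in> idl.span (I \<union> tail_ideal k)" and g: "g \<in> tail_ideal 1" for f g
      using f
    proof (induction rule: idl.span_induct_alt)
      case base then show ?case by (simp add: idl.span_zero)
    next
      case (step c x y)
      have "x * g \<in> idl.span ?R"
      proof (cases "x \<in> I")
        case True
        then have "g * x \<in> I" by (rule idl.subspace_scale[OF I])
        then show ?thesis by (intro idl.span_base) (simp add: mult.commute)
      next
        case False
        then have "x * g \<in> tail_ideal (k + 1)" using step g by (intro tail_ideal_mult) auto
        then show ?thesis by (intro idl.span_base) simp
      qed
      then have "c * (x * g) + y * g \<in> idl.span ?R"
        by (rule idl.span_add[OF idl.span_scale step.IH])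
      then show ?case by (simp only: distrib_right mult.assoc)
    qed
    then have "?L \<subseteq> idl.span ?R" by (auto intro: idl.span_base)
    then show "idl.span ?L \<subseteq> idl.span ?R" by (rule idl.span_minimal) simp
    have "tail_ideal (Suc k) \<subseteq> idl.span ?L"
    proof (rule tail_ideal_subset[OF idl.subspace_span])
      fix s :: "'n monom" assume "monom_degree s = Suc k"
      then obtain s1 s2 where s: "s = s1 + s2" "monom_degree s1 = k" "monom_degree s2 = 1"
        using monom_split[of s k 1] by auto
      then have "xpow s = (xpow s1 :: ('n, 'k) mpoly) * xpow s2" by (simp add: xpow_mult)
      moreover have "(xpow s1 :: ('n, 'k) mpoly) \<in> idl.span (I \<union> tail_ideal k)"
        using s by (intro idl.span_base) simp
      moreover have "(xpow s2 :: ('n, 'k) mpoly) \<in> tail_ideal 1" using s by simp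
      ultimately show "xpow s \<in> idl.span ?L" by (intro idl.span_base) blast
    qed
    then show "idl.span ?R \<subseteq> idl.span ?L"
      by (intro idl.span_minimal) (auto intro: idl.span_base)
  qed
  show ?case
    unfolding pow using Suc.IH ideal_m eq
    by (simp add: ideal_prod_is_ideal lift_ideal_prod lift_m)
qed

lemma reduction_at_iff:
  assumes J: "ideal J A" and "lift J \<subseteq> tail_ideal 1"
  shows "reduction_at A m J k \<longleftrightarrow> reduces_at I (lift J) k"
proof -
  interpret cring A by (rule cring_A)
  note mk = m_pow[of k] and mSk = m_pow[of "Suc k"]
  have eq: "idl.span (I \<union> {f * g | f g. f \<in> lift J \<and> g \<in> idl.span (I \<union> tail_ideal k)})
      = idl.span (I \<union> monomial_multiples (lift J) k)" (is "idl.span ?L = idl.span ?R")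
  proof (rule equalityI)
    have "f * g \<in> idl.span ?R" if f: "f \<in> lift J" and g: "g \<in> idl.span (I \<union> tail_ideal k)" for f g
      using g
    proof (induction rule: idl.span_induct_alt)
      case base then show ?case by (simp add: idl.span_zero)
    next
      case (step c x y)
      have "f * x \<in> idl.span ?R"
      proof (cases "x \<in> I")
        case True
        then have "f * x \<in> I" by (rule idl.subspace_scale[OF I])
        then show ?thesis by (intro idl.span_base) simp
      next
        case False
        have "tail_ideal k \<subseteq> {x. f * x \<in> idl.span ?R}"
        proof (rule tail_ideal_subset)
          show "idl.subspace {x. f * x \<in> idl.span ?R}"
          proof (rule idl.subspaceI)
            show "c * x \<in> {x. f * x \<in> idl.span ?R}" if "x \<in> {x. f * x \<in> idl.span ?R}" for c x
              using idl.span_scale[of "f * x" ?R c] that by (simp add: mult.left_commute)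
          qed (simp_all add: idl.span_zero idl.span_add distrib_left)
        next
          fix s :: "'n monom" assume "monom_degree s = k"
          then have "f * xpow s \<in> ?R" using f by (auto simp: monomial_multiples_def)
          then show "xpow s \<in> {x. f * x \<in> idl.span ?R}" by (auto intro: idl.span_base)
        qed
        then show ?thesis using step False by auto
      qed
      then have "c * (f * x) + f * y \<in> idl.span ?R"
        by (rule idl.span_add[OF idl.span_scale step.IH])
      then show ?case by (simp only: distrib_left mult.left_commute)
    qed
    then have "?L \<subseteq> idl.span ?R" by (auto intro: idl.span_base)
    then show "idl.span ?L \<subseteq> idl.span ?R" by (rule idl.span_minimal) simp
    have "f * xpow t \<in> ?L" if "f \<in> lift J" "monom_degree t = k" for f t
    proof -
      have "(xpow t :: ('n, 'k) mpoly) \<in> idl.span (I \<union> tail_ideal k)"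
        using that by (intro idl.span_base) simp
      then show ?thesis using that by blast
    qed
    then show "idl.span ?R \<subseteq> idl.span ?L"
      by (intro idl.span_mono) (auto simp: monomial_multiples_def)
  qed
  have "monomial_multiples (lift J) k \<subseteq> tail_ideal (Suc k)"
  proof -
    have "f * xpow t \<in> tail_ideal (1 + k)" if "f \<in> lift J" "monom_degree t = k" for f t
      using that assms(2) by (intro tail_ideal_mult) auto
    then show ?thesis by (auto simp: monomial_multiples_def)
  qed
  then have "idl.span (I \<union> monomial_multiples (lift J) k) \<subseteq> idl.span (I \<union> tail_ideal (Suc k))"
    by (intro idl.span_mono) auto
  moreover have "idl.span (I \<union> tail_ideal (Suc k)) \<subseteq> idl.span (I \<union> monomial_multiples (lift J) k)
      \<longleftrightarrow> reduces_at I (lift J) k"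
  proof
    assume *: "idl.span (I \<union> tail_ideal (Suc k)) \<subseteq> idl.span (I \<union> monomial_multiples (lift J) k)"
    show "reduces_at I (lift J) k"
      unfolding reduces_at_def
    proof (intro allI impI)
      fix s :: "'n monom" assume "monom_degree s = Suc k"
      then have "(xpow s :: ('n, 'k) mpoly) \<in> idl.span (I \<union> tail_ideal (Suc k))"
        by (intro idl.span_base) simp
      with * show "(xpow s :: ('n, 'k) mpoly) \<in> idl.span (I \<union> monomial_multiples (lift J) k)" by blast
    qed
  next
    assume "reduces_at I (lift J) k"
    then have "tail_ideal (Suc k) \<subseteq> idl.span (I \<union> monomial_multiples (lift J) k)"
      unfolding reduces_at_def by (intro tail_ideal_subset) auto
    then show "idl.span (I \<union> tail_ideal (Suc k)) \<subseteq> idl.span (I \<union> monomial_multiples (lift J) k)"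
      by (intro idl.span_minimal) (auto intro: idl.span_base)
  qed
  moreover have "reduction_at A m J k \<longleftrightarrow>
      idl.span (I \<union> monomial_multiples (lift J) k) = idl.span (I \<union> tail_ideal (Suc k))"
    unfolding reduction_at_def
    using lift_eq_iff[OF ideal_prod_is_ideal[OF J conjunct1[OF mk]] conjunct1[OF mSk]]
      lift_ideal_prod[OF J conjunct1[OF mk]] eq mk mSk by simp
  ultimately show ?thesis by blast
qed

lemma reduction_iff: "reduction A m J \<longleftrightarrow> ideal J A \<and> is_reduction I (lift J)"
proof (cases "ideal J A")
  case True
  note sub = subspace_lift[OF True] subset_lift[OF True]
  have m: "J \<subseteq> m \<longleftrightarrow> lift J \<subseteq> tail_ideal 1"
    using lift_subset_iff[OF True ideal_m] by (simp only: lift_m)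
  show ?thesis
  proof (cases "lift J \<subseteq> tail_ideal 1")
    case sub1: True
    show ?thesis
      unfolding reduction_def is_reduction_def m reduction_at_iff[OF True sub1]
      using True sub by (simp only: simp_thms)
  next
    case False
    then show ?thesis
      unfolding reduction_def is_reduction_def m by (simp only: simp_thms)
  qed
qed (simp add: reduction_def)

lemma minimal_reduction_iff:
  assumes J: "ideal J A"
  shows "minimal_reduction A m J \<longleftrightarrow> is_minimal_reduction I (lift J)"
proof
  assume *: "minimal_reduction A m J"
  show "is_minimal_reduction I (lift J)"
    unfolding is_minimal_reduction_def
  proof (intro conjI allI impI)
    show "is_reduction I (lift J)" using * by (simp add: minimal_reduction_def reduction_iff)
    fix L' assume L': "is_reduction I L' \<and> L' \<subseteq> lift J"
    have sub: "idl.subspace L'" "I \<subseteq> L'" using L' by (auto simp: is_reduction_def)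
    then have "reduction A m (cls ` L')"
      using L' by (simp add: reduction_iff ideal_image lift_image)
    moreover have "cls ` L' \<subseteq> J" using L' by (auto simp: lift_def)
    ultimately have "cls ` L' = J" using * unfolding minimal_reduction_def by blast
    then show "L' = lift J" using lift_image[OF sub] by simp
  qed
next
  assume *: "is_minimal_reduction I (lift J)"
  show "minimal_reduction A m J"
    unfolding minimal_reduction_def
  proof (intro conjI allI impI)
    show "reduction A m J" using * J by (simp add: is_minimal_reduction_def reduction_iff)
    fix J' assume J': "reduction A m J' \<and> J' \<subseteq> J"
    then have "ideal J' A" by (simp add: reduction_def)
    moreover have "is_reduction I (lift J')" "lift J' \<subseteq> lift J"
      using J' lift_subset_iff[OF \<open>ideal J' A\<close> J] by (simp_all only: reduction_iff)
    then have "lift J' = lift J" using * unfolding is_minimal_reduction_def by blast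
    ultimately show "J' = J" using lift_eq_iff J by (simp only:)
  qed
qed

text \<open>
  From here on the reduction number is a statement about ideals of the polynomial ring alone.
\<close>

lemma quot_reduction_number_eq:
  "quot_reduction_number I = (LEAST k. \<exists>L. is_minimal_reduction I L \<and> reduces_at I L k)"
proof -
  have "(\<exists>J. minimal_reduction A m J \<and> reduction_at A m J k) \<longleftrightarrow>
      (\<exists>L. is_minimal_reduction I L \<and> reduces_at I L k)" (is "?l \<longleftrightarrow> ?r") for k
  proof
    assume ?l
    then obtain J where J: "minimal_reduction A m J" "reduction_at A m J k" by blast
    then have "ideal J A" "lift J \<subseteq> tail_ideal 1"
      by (auto simp: minimal_reduction_def reduction_iff is_reduction_def)
    then have "is_minimal_reduction I (lift J)" "reduces_at I (lift J) k"
      using J minimal_reduction_iff[of J] reduction_at_iff[of J k] by (simp_all only:)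
    then show ?r by (intro exI conjI)
  next
    assume ?r
    then obtain L where L: "is_minimal_reduction I L" "reduces_at I L k" by blast
    then have *: "idl.subspace L" "I \<subseteq> L" "L \<subseteq> tail_ideal 1"
      by (auto simp: is_minimal_reduction_def is_reduction_def)
    then have "ideal (cls ` L) A" "lift (cls ` L) = L"
      by (auto simp: ideal_image lift_image)
    then have "minimal_reduction A m (cls ` L)" "reduction_at A m (cls ` L) k"
      using L * minimal_reduction_iff[of "cls ` L"] reduction_at_iff[of "cls ` L" k]
      by (simp_all only:)
    then show ?l by (intro exI conjI)
  qed
  then show ?thesis by (simp add: quot_reduction_number_def reduction_number_def)
qed

end

section \<open>Minimal reductions and linear forms\<close>

text \<open>
  For homogeneous \<open>I\<close> and linear forms \<open>W\<close> this is equivalent to \<open>W\<close> generating a reduction with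
  exponent \<open>k\<close>, but it does not mention products with powers of the maximal ideal, which makes it
  stable under replacing \<open>W\<close> by any set with the same span modulo \<open>I\<close>.
\<close>

definition lin_reduces ::
  "('n::finite, 'k::comm_ring_1) mpoly set \<Rightarrow> ('n, 'k) mpoly set \<Rightarrow> nat \<Rightarrow> bool" where
  "lin_reduces I W k \<longleftrightarrow> (\<forall>s. monom_degree s = Suc k \<longrightarrow> xpow s \<in> idl.span (I \<union> W))"

lemma lin_reduces_mono:
  assumes "lin_reduces I V k" "V \<subseteq> idl.span (I \<union> W)"
  shows "lin_reduces I W k"
proof -
  have "idl.span (I \<union> V) \<subseteq> idl.span (I \<union> W)"
    using assms(2) by (intro idl.span_minimal) (auto intro: idl.span_base)
  then show ?thesis using assms(1) by (auto simp: lin_reduces_def)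
qed

lemma homogeneous_idealD:
  assumes "homogeneous_ideal I"
  shows "idl.subspace I" "f \<in> I \<Longrightarrow> hom_component d f \<in> I"
  using assms by (auto simp: homogeneous_ideal_def ideal_poly_ring_iff)

lemma span_mult_closed:
  assumes "p \<in> idl.span S" "\<And>x. x \<in> S \<Longrightarrow> c * x \<in> idl.span T"
  shows "c * p \<in> idl.span (T :: 'a::comm_ring_1 set)"
  using assms(1)
proof (induction rule: idl.span_induct_alt)
  case base then show ?case by (simp add: idl.span_zero)
next
  case (step a x y)
  have "a * (c * x) + c * y \<in> idl.span T"
    by (rule idl.span_add[OF idl.span_scale[OF assms(2)[OF step(1)]] step.IH])
  then show ?case by (simp only: distrib_left mult.left_commute)
qed

lemma monomial_multiples_0: "monomial_multiples W 0 = W"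
proof -
  have "xpow 0 = (1 :: ('a, 'b) mpoly)" by simp
  then show ?thesis by (auto simp: monomial_multiples_def)
qed

lemma homog_mult_in_span_monomial_multiples:
  fixes h w :: "('n::finite, 'k::field) mpoly"
  assumes "homog d h" "w \<in> W"
  shows "h * w \<in> kv.span (monomial_multiples W d)"
proof -
  have "(\<Sum>s\<in>Poly_Mapping.keys h. cmul (Poly_Mapping.lookup h s) (w * xpow s)) \<in> kv.span (monomial_multiples W d)"
    using assms by (intro kv.span_sum kv.span_scale kv.span_base) (auto simp: monomial_multiples_def homog_def)
  moreover have "h * w = (\<Sum>s\<in>Poly_Mapping.keys h. cmul (Poly_Mapping.lookup h s) (w * xpow s))"
    by (subst (1) mpoly_expand[of h])
       (simp only: sum_distrib_right mult.assoc, simp only: mult.commute[of w])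
  ultimately show ?thesis by simp
qed

text \<open>
  Since \<open>I\<close> is homogeneous and \<open>W\<close> consists of linear forms, membership in the ideal \<open>I + (W)\<close> can be
  tested degree by degree, where it is a question about vector spaces.
\<close>

lemma hom_component_span:
  fixes p :: "('n::finite, 'k::field) mpoly"
  assumes I: "homogeneous_ideal I" and W: "\<And>w. w \<in> W \<Longrightarrow> homog 1 w"
    and p: "p \<in> idl.span (I \<union> W)"
  shows "hom_component (Suc d) p \<in> kv.span ({f \<in> I. homog (Suc d) f} \<union> monomial_multiples W d)"
  using p
proof (induction rule: idl.span_induct_alt)
  case base then show ?case by (simp add: kv.span_zero)
next
  case (step c x y)
  have "hom_component (Suc d) (c * x) \<in> kv.span ({f \<in> I. homog (Suc d) f} \<union> monomial_multiples W d)"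
  proof (cases "x \<in> I")
    case True
    then have "c * x \<in> I" by (rule idl.subspace_scale[OF homogeneous_idealD(1)[OF I]])
    then have "hom_component (Suc d) (c * x) \<in> I" by (rule homogeneous_idealD(2)[OF I])
    then show ?thesis by (intro kv.span_base) simp
  next
    case False
    then have x: "x \<in> W" using step by simp
    have "hom_component (Suc d) (c * x) = hom_component d c * x"
      by (subst hom_component_mult_homog[OF W[OF x]]) simp
    moreover have "hom_component d c * x \<in> kv.span (monomial_multiples W d)"
      by (rule homog_mult_in_span_monomial_multiples[OF homog_hom_component x])
    ultimately show ?thesis using kv.span_mono[of "monomial_multiples W d" "{f \<in> I. homog (Suc d) f} \<union> monomial_multiples W d"]
      by auto
  qed
  then show ?case unfolding hom_component_add by (rule kv.span_add[OF _ step.IH])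
qed

text \<open>
  Multiplication by \<open>c\<close> acts on linear parts through the constant coefficient of \<open>c\<close>; hence the linear
  parts of an ideal form a vector space and are controlled by the generators.
\<close>

lemma hom_component_1_mult:
  fixes f :: "('n::finite, 'k::field) mpoly"
  assumes "f \<in> tail_ideal 1"
  shows "hom_component 1 (c * f) = cmul (Poly_Mapping.lookup c 0) (hom_component 1 f)"
proof -
  define c' where "c' = c - cmul (Poly_Mapping.lookup c 0) 1"
  have "c' \<in> tail_ideal 1"
    by (auto simp: c'_def tail_ideal_altdef lookup_minus lookup_single)
  then have "c' * f \<in> tail_ideal (1 + 1)" using assms by (rule tail_ideal_mult)
  then have 0: "hom_component 1 (c' * f) = 0"
    by (intro poly_mapping_eqI) (auto simp: tail_ideal_altdef)
  have "c * f = c' * f + cmul (Poly_Mapping.lookup c 0) f"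
    by (simp add: c'_def left_diff_distrib)
  then show ?thesis by (simp only: hom_component_add hom_component_cmul 0 add_0_left)
qed

lemma tail_ideal_2I:
  assumes "f \<in> tail_ideal 1" "hom_component 1 f = w"
  shows "f - w \<in> tail_ideal 2"
proof -
  have "Poly_Mapping.lookup f s = Poly_Mapping.lookup w s" if "monom_degree s < 2" for s
  proof (cases "monom_degree s = 1")
    case True
    then show ?thesis using assms(2) by auto
  next
    case False
    then have "monom_degree s < 1" using that by linarith
    then show ?thesis using assms by (auto simp: tail_ideal_altdef)
  qed
  then show ?thesis by (simp add: tail_ideal_altdef lookup_minus)
qed

lemma tail_ideal_diff_hom_component:
  assumes "p \<in> tail_ideal d"
  shows "p - hom_component d p \<in> tail_ideal (Suc d)"
  using assms by (auto simp: tail_ideal_altdef lookup_minus less_Suc_eq)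

lemma reduces_at_imp_tail_subset:
  fixes L :: "('n::finite, 'k::field) mpoly set"
  assumes "reduces_at I L k" "idl.subspace L" "I \<subseteq> L"
  shows "tail_ideal (Suc k) \<subseteq> L"
proof (rule tail_ideal_subset[OF assms(2)])
  fix s :: "'n monom" assume "monom_degree s = Suc k"
  then have "xpow s \<in> idl.span (I \<union> monomial_multiples L k)" using assms(1) by (simp add: reduces_at_def)
  moreover have "idl.span (I \<union> monomial_multiples L k) \<subseteq> L"
  proof (rule idl.span_minimal[OF _ assms(2)])
    have "f * xpow t \<in> L" if "f \<in> L" for f t
      using idl.subspace_scale[OF assms(2) that, of "xpow t"] by (simp add: mult.commute)
    then show "I \<union> monomial_multiples L k \<subseteq> L" using assms(3) by (auto simp: monomial_multiples_def)
  qed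
  ultimately show "xpow s \<in> L" by blast
qed

text \<open>
  Take components of degree \<open>k + 1\<close>: in a product of an element of \<open>L\<close>, which has no constant term,
  with a monomial of degree \<open>k\<close>, only the linear part of the former contributes.
\<close>

lemma reduces_at_imp_lin_reduces:
  fixes I L :: "('n::finite, 'k::field) mpoly set"
  assumes I: "homogeneous_ideal I" and L: "L \<subseteq> tail_ideal 1" and red: "reduces_at I L k"
  shows "lin_reduces I (hom_component 1 ` L) k"
  unfolding lin_reduces_def
proof (intro allI impI)
  fix s :: "'n monom" assume s: "monom_degree s = Suc k"
  have "hom_component (Suc k) p \<in> idl.span (I \<union> hom_component 1 ` L)"
    if "p \<in> idl.span (I \<union> monomial_multiples L k)" for p
    using that
  proof (induction rule: idl.span_induct_alt)
    case base then show ?case by (simp add: idl.span_zero)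
  next
    case (step c x y)
    have "hom_component (Suc k) (c * x) \<in> idl.span (I \<union> hom_component 1 ` L)"
    proof (cases "x \<in> I")
      case True
      then have "c * x \<in> I" by (rule idl.subspace_scale[OF homogeneous_idealD(1)[OF I]])
      then have "hom_component (Suc k) (c * x) \<in> I" by (rule homogeneous_idealD(2)[OF I])
      then show ?thesis by (intro idl.span_base) simp
    next
      case False
      then obtain f t where x: "x = f * xpow t" "f \<in> L" "monom_degree t = k"
        using step(1) by (auto simp: monomial_multiples_def)
      have "homog k (xpow t :: ('n, 'k) mpoly)" using x by simp
      then have "hom_component (Suc k) (c * x) = hom_component 1 (c * f) * xpow t"
        unfolding x(1) by (simp add: hom_component_mult_homog flip: mult.assoc)
      also have "\<dots> = (xpow t * Poly_Mapping.single 0 (Poly_Mapping.lookup c 0)) * hom_component 1 f"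
        using x(2) L by (simp only: hom_component_1_mult subsetD mult.commute mult.left_commute)
      also have "\<dots> \<in> idl.span (I \<union> hom_component 1 ` L)"
        using x(2) by (intro idl.span_scale idl.span_base) simp
      finally show ?thesis .
    qed
    then show ?case unfolding hom_component_add by (rule idl.span_add[OF _ step.IH])
  qed
  moreover have "(xpow s :: ('n, 'k) mpoly) \<in> idl.span (I \<union> monomial_multiples L k)"
    using red s by (simp add: reduces_at_def)
  moreover have "hom_component (Suc k) (xpow s :: ('n, 'k) mpoly) = xpow s"
    using s by (subst hom_component_homog[of "Suc k"]) simp_all
  ultimately show "(xpow s :: ('n, 'k) mpoly) \<in> idl.span (I \<union> hom_component 1 ` L)" by metis
qed

lemma xpow_in_span_monomial_multiples:
  fixes I W :: "('n::finite, 'k::field) mpoly set"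
  assumes I: "homogeneous_ideal I" and W: "\<And>w. w \<in> W \<Longrightarrow> homog 1 w"
    and red: "lin_reduces I W k" and s: "monom_degree s = Suc k"
  shows "xpow s \<in> kv.span ({f \<in> I. homog (Suc k) f} \<union> monomial_multiples W k)"
proof -
  have "xpow s \<in> idl.span (I \<union> W)" using red s by (simp add: lin_reduces_def)
  from hom_component_span[OF I W this, of k] show ?thesis
    using s by (simp add: hom_component_homog[of "Suc k"])
qed

text \<open>
  Replacing a linear form by a lift changes products with monomials of degree \<open>k\<close> only in degrees
  above \<open>k + 1\<close>, and this error can be pushed to arbitrarily high degree by iteration. The iteration
  ends because \<open>L\<close> contains a power of the maximal ideal; without that assumption the claim
  fails, as \<open>L = (x + x\<^sup>2)\<close>, \<open>W = {x}\<close> and \<open>I = 0\<close> in one variable show.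
\<close>

lemma lin_reduces_imp_reduces_at:
  fixes I L W :: "('n::finite, 'k::field) mpoly set"
  assumes I: "homogeneous_ideal I" and W: "\<And>w. w \<in> W \<Longrightarrow> homog 1 w"
    and red: "lin_reduces I W k"
    and L: "idl.subspace L" "tail_ideal N \<subseteq> L"
    and lifts: "\<And>w. w \<in> W \<Longrightarrow> \<exists>f\<in>L. f - w \<in> tail_ideal 2"
  shows "reduces_at I L k"
proof -
  define Q where "Q = idl.span (I \<union> monomial_multiples L k)"
  have Q: "idl.subspace Q" "I \<subseteq> Q" "monomial_multiples L k \<subseteq> Q"
    by (auto simp: Q_def intro: idl.span_base)
  \<comment> \<open>Degree \<open>k + 1\<close> is in \<open>Q\<close> up to higher degree, ...\<close>
  have step1: "xpow s \<in> idl.span (Q \<union> tail_ideal (Suc (Suc k)))" (is "_ \<in> ?E")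
    if s: "monom_degree s = Suc k" for s
  proof -
    have "w * xpow t \<in> ?E" if wt: "w \<in> W" "monom_degree t = k" for w t
    proof -
      obtain f where f: "f \<in> L" "f - w \<in> tail_ideal 2" using lifts[OF wt(1)] by blast
      have "f * xpow t \<in> ?E"
        using f wt Q(3) by (intro idl.span_base) (auto simp: monomial_multiples_def)
      moreover have "(f - w) * xpow t \<in> tail_ideal (2 + k)"
        using f wt by (intro tail_ideal_mult) simp_all
      then have "(f - w) * xpow t \<in> ?E" by (intro idl.span_base) simp
      ultimately have "f * xpow t - (f - w) * xpow t \<in> ?E" by (rule idl.span_diff)
      then show ?thesis by (simp add: left_diff_distrib)
    qed
    then have "monomial_multiples W k \<subseteq> ?E" by (auto simp: monomial_multiples_def)
    then have "kv.span ({f \<in> I. homog (Suc k) f} \<union> monomial_multiples W k) \<subseteq> ?E"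
      using Q(2) by (intro kv.span_minimal subspace_idl_imp_kv idl.subspace_span)
        (auto intro: idl.span_base)
    then show ?thesis using xpow_in_span_monomial_multiples[OF I W red s] by blast
  qed
  \<comment> \<open>... so every degree from \<open>k + 1\<close> on is, ...\<close>
  have step2: "tail_ideal (Suc k + j) \<subseteq> idl.span (Q \<union> tail_ideal (Suc k + Suc j))" (is "_ \<subseteq> ?E") for j
  proof (rule tail_ideal_subset[OF idl.subspace_span])
    fix s :: "'n monom" assume "monom_degree s = Suc k + j"
    then obtain s1 s2 where s: "s = s1 + s2" "monom_degree s1 = Suc k" "monom_degree s2 = j"
      using monom_split by blast
    have "xpow s2 * xpow s1 \<in> ?E"
    proof (rule span_mult_closed[OF step1[OF s(2)]])
      fix x :: "('n, 'k) mpoly" assume "x \<in> Q \<union> tail_ideal (Suc (Suc k))"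
      then show "xpow s2 * x \<in> ?E"
      proof
        assume "x \<in> Q"
        then show ?thesis by (intro idl.span_scale idl.span_base) simp
      next
        assume "x \<in> tail_ideal (Suc (Suc k))"
        then have "xpow s2 * x \<in> tail_ideal (j + Suc (Suc k))"
          using s by (intro tail_ideal_mult) simp_all
        then show ?thesis by (intro idl.span_base) (simp add: add.commute)
      qed
    qed
    then show "xpow s \<in> ?E" by (simp add: s(1) xpow_mult add.commute)
  qed
  \<comment> \<open>... and the error can be moved beyond any given degree.\<close>
  have step3: "tail_ideal (Suc k) \<subseteq> idl.span (Q \<union> tail_ideal (Suc k + j))" for j
  proof (induction j)
    case 0 then show ?case by (auto intro: idl.span_base)
  next
    case (Suc j)
    have "idl.span (Q \<union> tail_ideal (Suc k + j)) \<subseteq> idl.span (Q \<union> tail_ideal (Suc k + Suc j))"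
      using step2[of j] by (intro idl.span_minimal idl.subspace_span) (auto intro: idl.span_base)
    then show ?case using Suc.IH by blast
  qed
  have "tail_ideal (Suc k + N) \<subseteq> Q"
  proof (rule tail_ideal_subset[OF Q(1)])
    fix s :: "'n monom" assume "monom_degree s = Suc k + N"
    then have "monom_degree s = 1 + (N + k)" by simp
    then obtain u v where s: "s = u + v" "monom_degree v = N + k"
      using monom_split by blast
    then obtain v1 v2 where v: "v = v1 + v2" "monom_degree v1 = N" "monom_degree v2 = k"
      using monom_split by blast
    then have "xpow v1 \<in> L" using L(2) by auto
    then have "xpow v1 * xpow v2 \<in> Q" using v Q(3) by (auto simp: monomial_multiples_def)
    then have "xpow u * (xpow v1 * xpow v2) \<in> Q" by (rule idl.subspace_scale[OF Q(1)])
    then show "xpow s \<in> Q" by (simp add: s v xpow_mult)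
  qed
  then have "Q \<union> tail_ideal (Suc k + N) \<subseteq> Q" by simp
  then have "idl.span (Q \<union> tail_ideal (Suc k + N)) \<subseteq> Q" by (rule idl.span_minimal[OF _ Q(1)])
  then have "tail_ideal (Suc k) \<subseteq> Q" using step3[of N] by blast
  then show ?thesis by (auto simp: reduces_at_def Q_def)
qed

lemma kv_subspace_linear_parts:
  assumes "idl.subspace L"
  shows "kv.subspace (hom_component d ` L :: ('n::finite, 'k::field) mpoly set)"
proof (rule kv.subspaceI)
  show "0 \<in> hom_component d ` L"
    using idl.subspace_0[OF assms] by (force simp: image_iff)
next
  fix x y assume "x \<in> hom_component d ` L" "y \<in> hom_component d ` L"
  then show "x + y \<in> hom_component d ` L"
    using idl.subspace_add[OF assms] by (auto simp flip: hom_component_add)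
next
  fix c x assume "x \<in> hom_component d ` L"
  then show "cmul c x \<in> hom_component d ` L"
    using idl.subspace_scale[OF assms] by (auto simp flip: hom_component_cmul)
qed

lemma lin_reduces_finite_subset:
  fixes I V :: "('n::finite, 'k::field) mpoly set"
  assumes "lin_reduces I V k"
  obtains W where "finite W" "W \<subseteq> V" "lin_reduces I W k"
proof -
  have "\<exists>T. finite T \<and> T \<subseteq> I \<union> V \<and> xpow s \<in> idl.span T" if "monom_degree s = Suc k" for s
  proof -
    have "xpow s \<in> idl.span (I \<union> V)" using assms that by (simp add: lin_reduces_def)
    then obtain T r where "finite T" "T \<subseteq> I \<union> V" "xpow s = (\<Sum>a\<in>T. r a * a)"
      unfolding idl.span_explicit by blast
    moreover have "(\<Sum>a\<in>T. r a * a) \<in> idl.span T"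
      by (intro idl.span_sum idl.span_scale idl.span_base)
    ultimately show ?thesis by auto
  qed
  then obtain T where T: "\<And>s. monom_degree s = Suc k \<Longrightarrow> finite (T s)"
    "\<And>s. monom_degree s = Suc k \<Longrightarrow> T s \<subseteq> I \<union> V"
    "\<And>s. monom_degree s = Suc k \<Longrightarrow> (xpow s :: ('n, 'k) mpoly) \<in> idl.span (T s)"
    by metis
  define W where "W = (\<Union>s\<in>{s. monom_degree s = Suc k}. T s) \<inter> V"
  show thesis
  proof (rule that)
    show "finite W" unfolding W_def using T(1) finite_monom_degree_eq by auto
    show "W \<subseteq> V" by (simp add: W_def)
    show "lin_reduces I W k"
      unfolding lin_reduces_def
    proof (intro allI impI)
      fix s :: "'n monom" assume s: "monom_degree s = Suc k"
      then have "T s \<subseteq> I \<union> W" using T(2)[OF s] by (auto simp: W_def)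
      then show "(xpow s :: ('n, 'k) mpoly) \<in> idl.span (I \<union> W)" using T(3)[OF s] idl.span_mono by blast
    qed
  qed
qed

text \<open>
  The set \<open>W\<close> has least size among all sets of linear parts of \<open>L\<close> that reduce \<open>I\<close> at some exponent
  \<open>k'\<close>. That it does so at the exponent \<open>k\<close> of \<open>L\<close> itself is due to the minimality of \<open>L\<close>: the ideal
  \<open>L'\<close> generated by lifts of \<open>W\<close> is a reduction inside \<open>L\<close>, so it equals \<open>L\<close>, and \<open>W\<close> spans the linear
  parts of \<open>L\<close> modulo \<open>I\<close>.
\<close>

lemma minimal_reduction_imp_lin_reduces:
  fixes I L :: "('n::finite, 'k::field) mpoly set"
  assumes I: "homogeneous_ideal I" and I1: "I \<subseteq> tail_ideal 1"
    and min: "is_minimal_reduction I L" and red: "reduces_at I L k"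
  obtains W where "finite W" "\<forall>w\<in>W. homog 1 w" "lin_reduces I W k"
    "\<forall>W' k'. finite W' \<and> W' \<subseteq> kv.span W \<and> lin_reduces I W' k' \<longrightarrow> card W \<le> card W'"
proof -
  have L: "idl.subspace L" "I \<subseteq> L" "L \<subseteq> tail_ideal 1"
    using min by (auto simp: is_minimal_reduction_def is_reduction_def)
  define V where "V = hom_component 1 ` L"
  have V: "kv.subspace V" unfolding V_def by (rule kv_subspace_linear_parts[OF L(1)])
  have redV: "lin_reduces I V k" unfolding V_def by (rule reduces_at_imp_lin_reduces[OF I L(3) red])
  let ?P = "\<lambda>W. finite W \<and> W \<subseteq> V \<and> (\<exists>k'. lin_reduces I W k')"
  have "\<exists>W. ?P W" using lin_reduces_finite_subset[OF redV] by metis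
  then obtain W where W: "?P W" "\<And>W'. ?P W' \<Longrightarrow> card W \<le> card W'"
    using ex_has_least_nat[of ?P _ card] by metis
  then obtain k' where k': "lin_reduces I W k'" by blast
  have homW: "homog 1 w" if "w \<in> W" for w using W(1) that by (auto simp: V_def)
  have "\<exists>f\<in>L. hom_component 1 f = w" if "w \<in> W" for w using W(1) that by (auto simp: V_def)
  then obtain \<phi> where \<phi>: "\<And>w. w \<in> W \<Longrightarrow> \<phi> w \<in> L" "\<And>w. w \<in> W \<Longrightarrow> hom_component 1 (\<phi> w) = w"
    by metis
  \<comment> \<open>The power of the maximal ideal that is adjoined must lie in \<open>L\<close>, which holds above degree \<open>k\<close>, and must not contribute linear parts, which fails in degree 1 when \<open>k = 0\<close>; the exponent \<open>k + 2\<close> serves both purposes.\<close>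
  define G where "G = I \<union> \<phi> ` W \<union> tail_ideal (Suc (Suc k))"
  define L' where "L' = idl.span G"
  have "tail_ideal (Suc (Suc k)) \<subseteq> tail_ideal (Suc k)" by (rule tail_ideal_antimono) simp
  then have G: "G \<subseteq> L"
    using L(2) \<phi>(1) reduces_at_imp_tail_subset[OF red L(1,2)] by (auto simp: G_def)
  then have sub: "L' \<subseteq> L" unfolding L'_def by (rule idl.span_minimal[OF _ L(1)])
  have "reduces_at I L' k'"
  proof (rule lin_reduces_imp_reduces_at[OF I homW k'])
    show "idl.subspace L'" by (simp add: L'_def)
    show "tail_ideal (Suc (Suc k)) \<subseteq> L'" by (auto simp: L'_def G_def intro: idl.span_base)
    show "\<exists>f\<in>L'. f - w \<in> tail_ideal 2" if "w \<in> W" for w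
    proof
      show "\<phi> w \<in> L'" using that by (auto simp: L'_def G_def intro: idl.span_base)
      show "\<phi> w - w \<in> tail_ideal 2" using \<phi> L(3) that by (intro tail_ideal_2I) auto
    qed
  qed
  then have "is_reduction I L'"
    using sub L(3) by (auto simp: is_reduction_def L'_def G_def intro: idl.span_base)
  then have L'L: "L' = L" using min sub by (auto simp: is_minimal_reduction_def)
  have lin: "hom_component 1 p \<in> kv.span (I \<union> W)" if "p \<in> idl.span G" for p
    using that
  proof (induction rule: idl.span_induct_alt)
    case base then show ?case by (simp add: kv.span_zero)
  next
    case (step c x y)
    have "x \<in> tail_ideal 1" using step(1) G L(3) by blast
    then have *: "hom_component 1 (c * x) = cmul (Poly_Mapping.lookup c 0) (hom_component 1 x)"
      by (rule hom_component_1_mult)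
    consider "x \<in> I" | w where "w \<in> W" "x = \<phi> w" | "x \<in> tail_ideal (Suc (Suc k))"
      using step(1) by (auto simp: G_def)
    then have "hom_component 1 x \<in> kv.span (I \<union> W)"
    proof cases
      case 1
      then show ?thesis using homogeneous_idealD(2)[OF I] by (intro kv.span_base) simp
    next
      case 2
      then show ?thesis using \<phi> by (intro kv.span_base) simp
    next
      case 3
      then have "hom_component 1 x = 0"
        by (intro poly_mapping_eqI) (auto simp: tail_ideal_altdef)
      then show ?thesis by (simp add: kv.span_zero)
    qed
    then have "hom_component 1 (c * x) \<in> kv.span (I \<union> W)"
      unfolding * by (rule kv.span_scale)
    then show ?case unfolding hom_component_add by (rule kv.span_add[OF _ step.IH])
  qed
  then have "V \<subseteq> kv.span (I \<union> W)" using L'L by (auto simp: V_def L'_def)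
  then have "V \<subseteq> idl.span (I \<union> W)" using kv_span_subset_idl_span by blast
  then have redW: "lin_reduces I W k" by (rule lin_reduces_mono[OF redV])
  have "kv.span W \<subseteq> V" using W(1) by (intro kv.span_minimal[OF _ V]) simp
  then have "\<forall>W' k'. finite W' \<and> W' \<subseteq> kv.span W \<and> lin_reduces I W' k' \<longrightarrow> card W \<le> card W'"
    using W(2) by blast
  with W(1) homW redW show thesis by (intro that[of W]) simp_all
qed

text \<open>
  A count of dimensions modulo \<open>U\<close>: a basis of \<open>U\<close> is extended to one of \<open>V\<close>, and the form \<open>w\<close> outside
  \<open>V\<close> makes the inequality strict.
\<close>

lemma proper_subspace_smaller_generators:
  fixes U V W :: "('n::finite, 'k::field) mpoly set"
  assumes U: "\<And>f. f \<in> U \<Longrightarrow> homog 1 f" "U \<subseteq> V" and V: "kv.subspace V" "V \<subseteq> kv.span (U \<union> W)"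
    and W: "finite W" and w: "w \<in> W" "w \<notin> V"
  obtains W' where "finite W'" "W' \<subseteq> V" "card W' < card W" "V \<subseteq> kv.span (U \<union> W')"
proof -
  obtain B where B: "B \<subseteq> U" "kv.independent B" "U \<subseteq> kv.span B"
    using kv.maximal_independent_subset[of U] by blast
  let ?X = "xpow ` {s :: 'n monom. monom_degree s = 1} :: ('n, 'k) mpoly set"
  have "finite ?X" using finite_monom_degree_eq by auto
  moreover have "B \<subseteq> kv.span ?X"
  proof
    fix b assume "b \<in> B"
    then have "homog 1 b" using U(1) B(1) by blast
    then have "xpow s \<in> ?X" if "s \<in> Poly_Mapping.keys b" for s
      using that by (auto simp: homog_def)
    then show "b \<in> kv.span ?X"
      by (rule in_subspace_if_monomials[OF kv.subspace_span kv.span_base])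
  qed
  ultimately have finB: "finite B" using kv.independent_span_bound B(2) by blast
  obtain C where C: "B \<subseteq> C" "C \<subseteq> V" "kv.independent C" "V \<subseteq> kv.span C"
    using kv.maximal_independent_subset_extend[of B V] B U(2) by blast
  have "kv.span C \<subseteq> V" using C(2) by (rule kv.span_minimal[OF _ V(1)])
  then have wC: "w \<notin> kv.span C" using w by blast
  then have ind: "kv.independent (insert w C)" using C(3) by (rule kv.independent_insertI)
  have "U \<union> W \<subseteq> kv.span (B \<union> W)"
    using B(3) kv.span_mono[of B "B \<union> W"] by (auto intro: kv.span_base)
  then have "kv.span (U \<union> W) \<subseteq> kv.span (B \<union> W)" by (rule kv.span_minimal) simp
  then have "insert w C \<subseteq> kv.span (B \<union> W)"
    using C(2) V(2) w(1) by (auto intro: kv.span_base)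
  then have le: "finite (insert w C)" "card (insert w C) \<le> card (B \<union> W)"
    using kv.independent_span_bound[OF _ ind, of "B \<union> W"] finB W by auto
  have "w \<notin> C" using wC kv.span_base by blast
  then have "card (insert w C) = Suc (card B + card (C - B))"
    using le(1) C(1) by (simp add: card_Diff_subset[OF finB C(1)] card_mono)
  moreover have "card (B \<union> W) \<le> card B + card W" by (rule card_Un_le)
  ultimately have "card (C - B) < card W" using le(2) by simp
  moreover have "C \<subseteq> U \<union> (C - B)" using B(1) by blast
  then have "V \<subseteq> kv.span (U \<union> (C - B))" using C(4) kv.span_mono by blast
  ultimately show thesis using that[of "C - B"] le(1) C(2) by auto
qed

text \<open>
  Let \<open>L'\<close> be a reduction inside \<open>L = I + (W)\<close>. Its linear parts reduce \<open>I\<close>, so they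
  contain \<open>W\<close> by the minimality of \<open>card W\<close>. This means that \<open>L\<close> equals \<open>L'\<close> up to elements of \<open>L\<close> of higher degree,
  and as in Nakayama's lemma the error can be pushed into a power of the maximal ideal that \<open>L'\<close>
  contains.
\<close>

lemma lin_reduces_imp_minimal_reduction:
  fixes I W :: "('n::finite, 'k::field) mpoly set"
  assumes I: "homogeneous_ideal I" and I1: "I \<subseteq> tail_ideal 1"
    and fin: "finite W" and lin: "\<forall>w\<in>W. homog 1 w" and red: "lin_reduces I W k"
    and min: "\<forall>W' k'. finite W' \<and> (\<forall>w\<in>W'. homog 1 w) \<and> lin_reduces I W' k' \<longrightarrow> card W \<le> card W'"
  shows "is_minimal_reduction I (idl.span (I \<union> W))" "reduces_at I (idl.span (I \<union> W)) k"
proof -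
  have W: "finite W" "\<And>w. w \<in> W \<Longrightarrow> homog 1 w" using fin lin by blast+
  define L where "L = idl.span (I \<union> W)"
  have L: "idl.subspace L" "I \<subseteq> L" "W \<subseteq> L" by (auto simp: L_def intro: idl.span_base)
  have W1: "W \<subseteq> tail_ideal 1" using W(2) homog_imp_tail_ideal by blast
  have L1: "L \<subseteq> tail_ideal 1" unfolding L_def
    using I1 W1 by (intro idl.span_minimal subspace_tail_ideal) simp
  have gens: "kv.span ({f \<in> I. homog (Suc j) f} \<union> monomial_multiples W j) \<subseteq> L" for j
  proof (rule kv.span_minimal[OF _ subspace_idl_imp_kv[OF L(1)]])
    have "f * xpow t \<in> L" if "f \<in> W" for f t
      using idl.subspace_scale[OF L(1), of f "xpow t"] L(3) that by (auto simp: mult.commute)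
    then show "{f \<in> I. homog (Suc j) f} \<union> monomial_multiples W j \<subseteq> L" using L(2) by (auto simp: monomial_multiples_def)
  qed
  have redL: "reduces_at I L k"
    unfolding reduces_at_def
  proof (intro allI impI)
    fix s :: "'n monom" assume s: "monom_degree s = Suc k"
    have "(xpow s :: ('n, 'k) mpoly) \<in> kv.span ({f \<in> I. homog (Suc k) f} \<union> monomial_multiples W k)"
      by (rule xpow_in_span_monomial_multiples[OF I W(2) red s])
    moreover have "kv.span ({f \<in> I. homog (Suc k) f} \<union> monomial_multiples W k) \<subseteq> kv.span (I \<union> monomial_multiples L k)"
      using L(3) by (intro kv.span_mono) (auto simp: monomial_multiples_def)
    ultimately show "(xpow s :: ('n, 'k) mpoly) \<in> idl.span (I \<union> monomial_multiples L k)"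
      using kv_span_subset_idl_span by blast
  qed
  then show "reduces_at I (idl.span (I \<union> W)) k" by (simp add: L_def)
  have "L' = L" if L': "is_reduction I L'" "L' \<subseteq> L" for L'
  proof -
    have L'': "idl.subspace L'" "I \<subseteq> L'" "L' \<subseteq> tail_ideal 1"
      using L' by (auto simp: is_reduction_def)
    obtain k' where k': "reduces_at I L' k'" using L' by (auto simp: is_reduction_def)
    define V where "V = hom_component 1 ` L'"
    have V: "kv.subspace V" unfolding V_def by (rule kv_subspace_linear_parts[OF L''(1)])
    have redV: "lin_reduces I V k'"
      unfolding V_def by (rule reduces_at_imp_lin_reduces[OF I L''(3) k'])
    define U where "U = {f \<in> I. homog 1 f}"
    have UV: "U \<subseteq> V"
    proof
      fix f assume f: "f \<in> U"
      then have "hom_component 1 f = f"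
        using hom_component_homog[of 1 f 1] by (simp add: U_def)
      moreover have "f \<in> L'" using f L''(2) by (auto simp: U_def)
      ultimately show "f \<in> V" unfolding V_def by force
    qed
    have VUW: "V \<subseteq> kv.span (U \<union> W)"
      unfolding V_def
    proof (rule image_subsetI)
      fix f assume "f \<in> L'"
      then have "f \<in> idl.span (I \<union> W)" using L'(2) by (auto simp: L_def)
      from hom_component_span[OF I W(2) this, of 0]
      show "hom_component 1 f \<in> kv.span (U \<union> W)" by (simp add: monomial_multiples_0 U_def)
    qed
    have WV: "W \<subseteq> V"
    proof (rule ccontr)
      assume "\<not> W \<subseteq> V"
      then obtain w where w: "w \<in> W" "w \<notin> V" by blast
      have "homog 1 f" if "f \<in> U" for f using that by (simp add: U_def)
      then obtain W' where W': "finite W'" "W' \<subseteq> V" "card W' < card W" "V \<subseteq> kv.span (U \<union> W')"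
        using proper_subspace_smaller_generators[OF _ UV V VUW W(1) w] by blast
      have "U \<union> W' \<subseteq> I \<union> W'" by (auto simp: U_def)
      then have "V \<subseteq> idl.span (I \<union> W')"
        using W'(4) kv.span_mono[of "U \<union> W'" "I \<union> W'"] kv_span_subset_idl_span by blast
      then have "lin_reduces I W' k'" by (rule lin_reduces_mono[OF redV])
      moreover have "\<forall>w\<in>W'. homog 1 w" using W'(2) by (auto simp: V_def)
      ultimately have "card W \<le> card W'" using min W'(1) by blast
      then show False using W'(3) by simp
    qed
    have step: "L \<inter> tail_ideal (Suc j) \<subseteq> idl.span (L' \<union> (L \<inter> tail_ideal (Suc (Suc j))))"
      (is "_ \<subseteq> ?E") for j
    proof
      fix p assume p: "p \<in> L \<inter> tail_ideal (Suc j)"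
      let ?h = "hom_component (Suc j) p"
      have h: "?h \<in> kv.span ({f \<in> I. homog (Suc j) f} \<union> monomial_multiples W j)"
        using p hom_component_span[OF I W(2)] by (auto simp: L_def)
      have "w * xpow t \<in> ?E" if wt: "w \<in> W" "monom_degree t = j" for w t
      proof -
        obtain f where f: "f \<in> L'" "hom_component 1 f = w" using WV wt by (auto simp: V_def)
        then have "f - w \<in> tail_ideal 2" using L''(3) by (intro tail_ideal_2I) auto
        then have "xpow t * (f - w) \<in> tail_ideal (j + 2)"
          using wt by (intro tail_ideal_mult) simp_all
        moreover have "f - w \<in> L" using f wt L(3) L'(2) by (intro idl.subspace_diff[OF L(1)]) auto
        then have "xpow t * (f - w) \<in> L" by (rule idl.subspace_scale[OF L(1)])
        ultimately have "xpow t * (f - w) \<in> ?E" by (intro idl.span_base) simp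
        moreover have "xpow t * f \<in> ?E" using f by (intro idl.span_scale idl.span_base) simp
        ultimately have "xpow t * f - xpow t * (f - w) \<in> ?E" by (intro idl.span_diff)
        moreover have "xpow t * f - xpow t * (f - w) = w * xpow t"
          by (simp only: flip: right_diff_distrib) (simp add: mult.commute)
        ultimately show ?thesis by simp
      qed
      then have "{f \<in> I. homog (Suc j) f} \<union> monomial_multiples W j \<subseteq> ?E"
        using L''(2) by (auto simp: monomial_multiples_def intro: idl.span_base)
      then have "kv.span ({f \<in> I. homog (Suc j) f} \<union> monomial_multiples W j) \<subseteq> ?E"
        by (intro kv.span_minimal subspace_idl_imp_kv idl.subspace_span)
      then have "?h \<in> ?E" using h by blast
      moreover have "p - ?h \<in> L" using p h gens[of j] by (intro idl.subspace_diff[OF L(1)]) auto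
      then have "p - ?h \<in> ?E"
        using tail_ideal_diff_hom_component[of p "Suc j"] p by (intro idl.span_base) simp
      ultimately have "?h + (p - ?h) \<in> ?E" by (intro idl.span_add)
      then show "p \<in> ?E" by simp
    qed
    have "L \<subseteq> idl.span (L' \<union> (L \<inter> tail_ideal (Suc j)))" for j
    proof (induction j)
      case 0
      then show ?case using L1 by (auto intro: idl.span_base)
    next
      case (Suc j)
      have "idl.span (L' \<union> (L \<inter> tail_ideal (Suc j))) \<subseteq> idl.span (L' \<union> (L \<inter> tail_ideal (Suc (Suc j))))"
        using step[of j] by (intro idl.span_minimal idl.subspace_span) (auto intro: idl.span_base)
      then show ?case using Suc.IH by blast
    qed
    moreover have "idl.span (L' \<union> (L \<inter> tail_ideal (Suc k'))) \<subseteq> L'"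
      using reduces_at_imp_tail_subset[OF k' L''(1,2)] by (intro idl.span_minimal[OF _ L''(1)]) blast
    ultimately have "L \<subseteq> L'" by blast
    then show ?thesis using L'(2) by (intro equalityI)
  qed
  moreover have "is_reduction I L" using L L1 redL by (auto simp: is_reduction_def)
  ultimately show "is_minimal_reduction I (idl.span (I \<union> W))"
    by (auto simp: is_minimal_reduction_def L_def)
qed

section \<open>Polynomial functions and algebraic relations\<close>

text \<open>
  Over an infinite field a polynomial that vanishes as a function has zero coefficients. The polynomial
  is given as a family of terms whose exponents may coincide, so that the Leibniz formula for a
  determinant can be inserted directly; the sum on the left is the coefficient of the exponent \<open>\<theta>\<close>.
\<close>

lemma sum_coeffs_zero_if_poly_fun_zero:
  fixes C :: "'i \<Rightarrow> 'k::field" and E :: "'i \<Rightarrow> 'x \<Rightarrow> nat"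
  assumes inf: "infinite (UNIV :: 'k set)" and "finite T" "finite S"
    and "\<And>y. (\<Sum>i\<in>S. C i * (\<Prod>x\<in>T. y x ^ E i x)) = 0"
  shows "(\<Sum>i\<in>{i \<in> S. \<forall>x\<in>T. E i x = \<theta> x}. C i) = 0"
  using assms(2-)
proof (induction T arbitrary: S rule: finite_induct)
  case empty
  then show ?case by simp
next
  case (insert x T)
  let ?S = "{i \<in> S. E i x = \<theta> x}"
  have "(\<Sum>i\<in>?S. C i * (\<Prod>x\<in>T. y x ^ E i x)) = 0" for y
  proof -
    define p where "p = (\<Sum>i\<in>S. Polynomial.monom (C i * (\<Prod>x\<in>T. y x ^ E i x)) (E i x))"
    have "poly p z = 0" for z
    proof -
      have "(\<Prod>x'\<in>T. (y(x := z)) x' ^ E i x') = (\<Prod>x'\<in>T. y x' ^ E i x')" for i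
        using insert.hyps by (intro prod.cong) auto
      then have "C i * (\<Prod>x'\<in>insert x T. (y(x := z)) x' ^ E i x') =
          poly (Polynomial.monom (C i * (\<Prod>x\<in>T. y x ^ E i x)) (E i x)) z" for i
        using insert.hyps by (simp add: poly_monom mult_ac)
      then show ?thesis
        using insert.prems(2)[of "y(x := z)"] by (simp add: p_def poly_sum)
    qed
    then have "p = 0" using poly_roots_finite[of p] inf by auto
    then have "Polynomial.coeff p (\<theta> x) = 0" by simp
    then show ?thesis
      by (simp add: p_def coeff_sum sum.inter_filter[OF insert.prems(1)])
  qed
  from insert.IH[OF _ this] insert.prems(1) have "(\<Sum>i\<in>{i \<in> ?S. \<forall>x\<in>T. E i x = \<theta> x}. C i) = 0" by simp
  moreover have "{i \<in> ?S. \<forall>x\<in>T. E i x = \<theta> x} = {i \<in> S. \<forall>x\<in>insert x T. E i x = \<theta> x}" by auto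
  ultimately show ?case by simp
qed

lemma homog_one: "homog 0 1"
  by (simp add: homog_def)

lemma homog_power: "homog d p \<Longrightarrow> homog (d * n) (p ^ n)"
  by (induction n) (auto simp: homog_one dest: homog_mult)

lemma homog_prod_power:
  assumes "\<And>w. w \<in> W \<Longrightarrow> homog 1 w"
  shows "homog (\<Sum>w\<in>W. \<alpha> w) (\<Prod>w\<in>W. w ^ \<alpha> w)"
  using assms
proof (induction W rule: infinite_finite_induct)
  case (insert x F)
  then show ?case using homog_mult[OF homog_power[of 1 x "\<alpha> x"], of _ "\<Prod>w\<in>F. w ^ \<alpha> w"] by simp
qed (auto simp: homog_one)

lemma single_0_power: "(Poly_Mapping.single 0 b :: ('n, 'k::comm_ring_1) mpoly) ^ n = Poly_Mapping.single 0 (b ^ n)"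
  by (induction n) (simp_all add: mult_single)

lemma single_0_prod: "(\<Prod>x\<in>T. Poly_Mapping.single 0 (f x) :: ('n, 'k::comm_ring_1) mpoly) = Poly_Mapping.single 0 (\<Prod>x\<in>T. f x)"
  by (induction T rule: infinite_finite_induct) (simp_all add: mult_single)

lemma ideal_cong_mult:
  fixes Z :: "'a::comm_ring_1 set"
  assumes Z: "idl.subspace Z" and "x - y \<in> Z" "x' - y' \<in> Z"
  shows "x * x' - y * y' \<in> Z"
proof -
  have "x' * (x - y) + y * (x' - y') \<in> Z"
    by (intro idl.subspace_add[OF Z] idl.subspace_scale[OF Z] assms)
  moreover have "x' * (x - y) + y * (x' - y') = x * x' - y * y'"
    by (simp add: right_diff_distrib mult.commute)
  ultimately show ?thesis by simp
qed

lemma ideal_cong_power: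
  fixes Z :: "'a::comm_ring_1 set"
  assumes Z: "idl.subspace Z" and "x - y \<in> Z"
  shows "x ^ n - y ^ n \<in> Z"
  by (induction n) (use idl.subspace_0[OF Z] ideal_cong_mult[OF Z assms(2)] in auto)

lemma ideal_cong_prod:
  fixes Z :: "'a::comm_ring_1 set"
  assumes Z: "idl.subspace Z" and "\<And>i. i \<in> T \<Longrightarrow> f i - g i \<in> Z"
  shows "(\<Prod>i\<in>T. f i) - (\<Prod>i\<in>T. g i) \<in> Z"
  using assms(2)
  by (induction T rule: infinite_finite_induct) (use idl.subspace_0[OF Z] in \<open>auto intro: ideal_cong_mult[OF Z]\<close>)

text \<open>
  One step of Noether normalisation. A homogeneous relation \<open>F(W) \<in> U\<close> with \<open>F(b) \<noteq> 0\<close> at a point with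
  \<open>b w0 = 1\<close> becomes monic in \<open>w0\<close> after \<open>w\<close> is replaced by \<open>w - b w \<cdot> w0\<close> for all \<open>w \<noteq> w0\<close>. Modulo
  \<open>U\<close> and these new forms, every monomial of degree \<open>k + 1\<close> is a multiple of \<open>w0\<close>, hence a product of
  \<open>D\<close> such monomials is a multiple of \<open>w0 ^ D\<close>, which is zero by the relation.
\<close>

lemma algebraic_relation_imp_smaller:
  fixes U W :: "('n::finite, 'k::field) mpoly set"
  assumes inf: "infinite (UNIV :: 'k set)"
    and U: "homogeneous_ideal U" "U \<subseteq> tail_ideal 1"
    and W: "finite W" "\<And>w. w \<in> W \<Longrightarrow> homog 1 w" and red: "lin_reduces U W k"
    and A: "finite A" "A \<subseteq> extensional W"
    and rel: "(\<Sum>\<alpha>\<in>A. cmul (d \<alpha>) (\<Prod>w\<in>W. w ^ \<alpha> w)) \<in> U"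
    and \<alpha>0: "\<alpha>0 \<in> A" "d \<alpha>0 \<noteq> 0"
  shows "\<exists>W' k'. finite W' \<and> W' \<subseteq> kv.span W \<and> lin_reduces U W' k' \<and> card W' < card W"
proof -
  \<comment> \<open>As \<open>U\<close> is homogeneous, the part of degree \<open>D\<close> of the relation is a relation as well.\<close>
  define D where "D = (\<Sum>w\<in>W. \<alpha>0 w)"
  define S where "S = {\<alpha> \<in> A. (\<Sum>w\<in>W. \<alpha> w) = D}"
  have S: "finite S" "S \<subseteq> A" "\<alpha>0 \<in> S" using A(1) \<alpha>0 by (auto simp: S_def D_def)
  define F where "F = (\<Sum>\<alpha>\<in>S. cmul (d \<alpha>) (\<Prod>w\<in>W. w ^ \<alpha> w))"
  have "F = hom_component D (\<Sum>\<alpha>\<in>A. cmul (d \<alpha>) (\<Prod>w\<in>W. w ^ \<alpha> w))"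
  proof -
    have "hom_component D (cmul (d \<alpha>) (\<Prod>w\<in>W. w ^ \<alpha> w)) =
        (if (\<Sum>w\<in>W. \<alpha> w) = D then cmul (d \<alpha>) (\<Prod>w\<in>W. w ^ \<alpha> w) else 0)" for \<alpha>
      unfolding hom_component_cmul
      using hom_component_homog[OF homog_prod_power[of W \<alpha>, OF W(2)], of D] by auto
    then show ?thesis unfolding F_def S_def hom_component_sum
      by (simp only: sum.inter_filter[OF A(1)])
  qed
  then have FU: "F \<in> U" using homogeneous_idealD(2)[OF U(1) rel] by simp
  have S_eq: "\<alpha> = \<beta>" if "\<alpha> \<in> S" "\<beta> \<in> S" "\<And>w. w \<in> W \<Longrightarrow> \<alpha> w = \<beta> w" for \<alpha> \<beta>
    using that A(2) S(2) extensionalityI[of \<alpha> W \<beta>] by blast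
  have "\<exists>c. (\<Sum>\<alpha>\<in>S. d \<alpha> * (\<Prod>w\<in>W. c w ^ \<alpha> w)) \<noteq> 0"
  proof (rule ccontr)
    assume "\<not> ?thesis"
    then have "(\<Sum>\<alpha>\<in>{\<alpha> \<in> S. \<forall>w\<in>W. \<alpha> w = \<alpha>0 w}. d \<alpha>) = 0"
      by (intro sum_coeffs_zero_if_poly_fun_zero[OF inf W(1) S(1)]) blast
    moreover have "{\<alpha> \<in> S. \<forall>w\<in>W. \<alpha> w = \<alpha>0 w} = {\<alpha>0}"
    proof (intro equalityI subsetI)
      fix \<alpha> assume "\<alpha> \<in> {\<alpha> \<in> S. \<forall>w\<in>W. \<alpha> w = \<alpha>0 w}"
      then have "\<alpha> = \<alpha>0" by (intro S_eq[OF _ S(3)]) simp_all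
      then show "\<alpha> \<in> {\<alpha>0}" by simp
    qed (use S(3) in simp)
    ultimately show False using \<alpha>0(2) by simp
  qed
  then obtain c where c: "(\<Sum>\<alpha>\<in>S. d \<alpha> * (\<Prod>w\<in>W. c w ^ \<alpha> w)) \<noteq> 0" by blast
  \<comment> \<open>A relation of degree 0 would put a nonzero constant into \<open>U\<close>.\<close>
  have "D > 0"
  proof (rule ccontr)
    assume "\<not> D > 0"
    then have 0: "\<alpha> w = 0" if "\<alpha> \<in> S" "w \<in> W" for \<alpha> w using that W(1) by (simp add: S_def)
    have "\<alpha> = \<alpha>0" if "\<alpha> \<in> S" for \<alpha>
      using 0[OF that] 0[OF S(3)] by (intro S_eq[OF that S(3)]) simp
    then have "S = {\<alpha>0}" using S(3) by blast
    moreover have "(\<Prod>w\<in>W. w ^ \<alpha>0 w) = (1 :: ('n, 'k) mpoly)"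
      using 0[OF S(3)] by (intro prod.neutral) simp
    ultimately have "F = cmul (d \<alpha>0) 1" by (simp only: F_def) simp
    then have "Poly_Mapping.lookup F 0 = d \<alpha>0" by simp
    moreover have "F \<in> tail_ideal 1" using FU U(2) by blast
    then have "Poly_Mapping.lookup F 0 = 0" by (simp add: tail_ideal_altdef)
    ultimately show False using \<alpha>0(2) by simp
  qed
  have "\<exists>w0\<in>W. c w0 \<noteq> 0"
  proof (rule ccontr)
    assume *: "\<not> ?thesis"
    have "(\<Prod>w\<in>W. c w ^ \<alpha> w) = 0" if "\<alpha> \<in> S" for \<alpha>
    proof -
      have "(\<Sum>w\<in>W. \<alpha> w) \<noteq> 0" using that \<open>D > 0\<close> by (simp add: S_def)
      then obtain w where "w \<in> W" "\<alpha> w \<noteq> 0" by (meson sum.neutral)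
      then show ?thesis using * W(1) by (intro prod_zero) (auto intro!: bexI[of _ w])
    qed
    then show False using c by simp
  qed
  then obtain w0 where w0: "w0 \<in> W" "c w0 \<noteq> 0" by blast
  define b where "b w = c w / c w0" for w
  have Fb: "(\<Sum>\<alpha>\<in>S. d \<alpha> * (\<Prod>w\<in>W. b w ^ \<alpha> w)) \<noteq> 0"
  proof -
    have "(\<Prod>w\<in>W. b w ^ \<alpha> w) = (\<Prod>w\<in>W. c w ^ \<alpha> w) / c w0 ^ D" if "\<alpha> \<in> S" for \<alpha>
      using that by (simp add: b_def power_divide prod_dividef S_def flip: power_sum)
    then have "(\<Sum>\<alpha>\<in>S. d \<alpha> * (\<Prod>w\<in>W. b w ^ \<alpha> w)) = (\<Sum>\<alpha>\<in>S. d \<alpha> * (\<Prod>w\<in>W. c w ^ \<alpha> w)) / c w0 ^ D"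
      by (simp add: sum_divide_distrib)
    then show ?thesis using c w0 by simp
  qed
  define W' where "W' = (\<lambda>w. w - cmul (b w) w0) ` (W - {w0})"
  define Z where "Z = idl.span (U \<union> W')"
  have Z: "idl.subspace Z" "U \<subseteq> Z" "W' \<subseteq> Z" by (auto simp: Z_def intro: idl.span_base)
  have bw0: "b w0 = 1" using w0 by (simp add: b_def)
  have w_cong: "w - cmul (b w) w0 \<in> Z" if "w \<in> W" for w
  proof (cases "w = w0")
    case True
    then show ?thesis using idl.subspace_0[OF Z(1)] by (simp add: bw0)
  next
    case False
    then show ?thesis using that Z(3) by (auto simp: W'_def)
  qed
  have prod_cong: "(\<Prod>w\<in>W. w ^ \<alpha> w) - cmul (\<Prod>w\<in>W. b w ^ \<alpha> w) (w0 ^ D) \<in> Z" if "\<alpha> \<in> S" for \<alpha>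
  proof -
    have "(\<Prod>w\<in>W. w ^ \<alpha> w) - (\<Prod>w\<in>W. (cmul (b w) w0) ^ \<alpha> w) \<in> Z"
      by (intro ideal_cong_prod[OF Z(1)] ideal_cong_power[OF Z(1)] w_cong)
    moreover have "(\<Prod>w\<in>W. (cmul (b w) w0) ^ \<alpha> w) = cmul (\<Prod>w\<in>W. b w ^ \<alpha> w) (w0 ^ D)"
      using that by (simp add: power_mult_distrib single_0_power prod.distrib single_0_prod S_def flip: power_sum)
    ultimately show ?thesis by simp
  qed
  have w0D: "w0 ^ D \<in> Z"
  proof -
    let ?q = "\<Sum>\<alpha>\<in>S. d \<alpha> * (\<Prod>w\<in>W. b w ^ \<alpha> w)"
    have "(\<Sum>\<alpha>\<in>S. cmul (d \<alpha>) ((\<Prod>w\<in>W. w ^ \<alpha> w) - cmul (\<Prod>w\<in>W. b w ^ \<alpha> w) (w0 ^ D))) \<in> Z"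
      by (intro idl.subspace_sum[OF Z(1)] idl.subspace_scale[OF Z(1)] prod_cong)
    moreover have "(\<Sum>\<alpha>\<in>S. cmul (d \<alpha>) ((\<Prod>w\<in>W. w ^ \<alpha> w) - cmul (\<Prod>w\<in>W. b w ^ \<alpha> w) (w0 ^ D)))
        = F - cmul ?q (w0 ^ D)"
      by (intro poly_mapping_eqI)
         (simp add: F_def lookup_sum lookup_minus right_diff_distrib sum_subtractf sum_distrib_right mult.assoc)
    ultimately have "F - cmul ?q (w0 ^ D) \<in> Z" by simp
    moreover have "F \<in> Z" using FU Z(2) by blast
    ultimately have "F - (F - cmul ?q (w0 ^ D)) \<in> Z" using idl.subspace_diff[OF Z(1)] by blast
    then have "cmul ?q (w0 ^ D) \<in> Z" by simp
    then have "cmul (inverse ?q) (cmul ?q (w0 ^ D)) \<in> Z" by (rule idl.subspace_scale[OF Z(1)])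
    moreover have "cmul (inverse ?q) (cmul ?q (w0 ^ D)) = w0 ^ D"
      using Fb by (intro poly_mapping_eqI) simp
    ultimately show ?thesis by simp
  qed
  have gen: "\<exists>h. xpow s - h * w0 \<in> Z" if s: "monom_degree s = Suc k" for s
  proof -
    have "xpow s \<in> idl.span (U \<union> W)" using red s by (simp add: lin_reduces_def)
    then show ?thesis
    proof (induction rule: idl.span_induct_alt)
      case base
      show ?case using idl.subspace_0[OF Z(1)] by (intro exI[of _ 0]) simp
    next
      case (step a x y)
      obtain h where h: "y - h * w0 \<in> Z" using step by blast
      have "\<exists>h'. x - h' * w0 \<in> Z"
      proof (cases "x \<in> U")
        case True
        then show ?thesis using Z(2) by (intro exI[of _ 0]) auto
      next
        case False
        then show ?thesis using w_cong[of x] step by blast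
      qed
      then obtain h' where h': "x - h' * w0 \<in> Z" by blast
      have "a * (x - h' * w0) + (y - h * w0) \<in> Z"
        by (intro idl.subspace_add[OF Z(1)] idl.subspace_scale[OF Z(1)] h h')
      moreover have "a * (x - h' * w0) + (y - h * w0) = (a * x + y) - (a * h' + h) * w0"
        by (simp add: right_diff_distrib distrib_right mult.assoc)
      ultimately show ?case by metis
    qed
  qed
  have gens: "\<exists>h. xpow s - h * w0 ^ j \<in> Z" if "monom_degree s = j * Suc k" for s j
    using that
  proof (induction j arbitrary: s)
    case 0
    show ?case using idl.subspace_0[OF Z(1)] by (intro exI[of _ "xpow s"]) simp
  next
    case (Suc j)
    then have "monom_degree s = Suc k + j * Suc k" by simp
    then obtain s1 s2 where s: "s = s1 + s2" "monom_degree s1 = Suc k" "monom_degree s2 = j * Suc k"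
      using monom_split by blast
    obtain h1 h2 where "xpow s1 - h1 * w0 \<in> Z" "xpow s2 - h2 * w0 ^ j \<in> Z"
      using gen[OF s(2)] Suc.IH[OF s(3)] by blast
    then have "xpow s1 * xpow s2 - (h1 * w0) * (h2 * w0 ^ j) \<in> Z" by (rule ideal_cong_mult[OF Z(1)])
    moreover have "(h1 * w0) * (h2 * w0 ^ j) = (h1 * h2) * w0 ^ Suc j" by (simp add: mult_ac)
    ultimately show ?case unfolding s(1) xpow_mult by metis
  qed
  have "lin_reduces U W' (D * Suc k - 1)"
    unfolding lin_reduces_def
  proof (intro allI impI)
    fix s :: "'n monom" assume "monom_degree s = Suc (D * Suc k - 1)"
    then have "monom_degree s = D * Suc k" using \<open>D > 0\<close> by simp
    from gens[OF this] obtain h where h: "xpow s - h * w0 ^ D \<in> Z" by blast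
    have "h * w0 ^ D \<in> Z" by (rule idl.subspace_scale[OF Z(1) w0D])
    from idl.subspace_add[OF Z(1) h this] show "(xpow s :: ('n, 'k) mpoly) \<in> idl.span (U \<union> W')"
      by (simp add: Z_def)
  qed
  moreover have "finite W'" using W(1) by (simp add: W'_def)
  moreover have "W' \<subseteq> kv.span W"
    using w0(1) by (auto simp: W'_def intro!: kv.span_diff kv.span_scale intro: kv.span_base)
  moreover have "card W' < card W"
  proof -
    have "card W' \<le> card (W - {w0})" unfolding W'_def using W(1) by (intro card_image_le) simp
    also have "\<dots> < card W" using W(1) w0(1) by (intro psubset_card_mono) auto
    finally show ?thesis .
  qed
  ultimately show ?thesis by blast
qed

section \<open>Counting dimensions\<close>

text \<open>
  Gaussian elimination, one equation at a time.
\<close>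

lemma underdetermined_system_solvable:
  fixes c :: "'x \<Rightarrow> 'y \<Rightarrow> 'k::field"
  assumes "finite Y" "finite T" "card Y < card T"
  shows "\<exists>d. (\<exists>x\<in>T. d x \<noteq> 0) \<and> (\<forall>y\<in>Y. (\<Sum>x\<in>T. d x * c x y) = 0)"
  using assms
proof (induction Y arbitrary: T c rule: finite_induct)
  case empty
  then have "T \<noteq> {}" by auto
  then show ?case by (intro exI[of _ "\<lambda>_. 1"]) auto
next
  case (insert y Y)
  show ?case
  proof (cases "\<forall>x\<in>T. c x y = 0")
    case True
    have "card Y < card T" using insert by simp
    from insert.IH[OF insert.prems(1) this, of c] obtain d where
      "\<exists>x\<in>T. d x \<noteq> 0" "\<forall>y\<in>Y. (\<Sum>x\<in>T. d x * c x y) = 0" by blast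
    then show ?thesis using True by (intro exI[of _ d]) simp
  next
    case False
    then obtain x0 where x0: "x0 \<in> T" "c x0 y \<noteq> 0" by blast
    define c' where "c' x z = c x z - (c x y / c x0 y) * c x0 z" for x z
    have "card Y < card (T - {x0})" using insert x0 by simp
    from insert.IH[OF _ this, of c'] insert.prems(1) obtain d where
      d: "\<exists>x\<in>T - {x0}. d x \<noteq> 0" "\<forall>z\<in>Y. (\<Sum>x\<in>T - {x0}. d x * c' x z) = 0" by auto
    define e where "e = d(x0 := - (\<Sum>x\<in>T - {x0}. d x * (c x y / c x0 y)))"
    have e: "(\<Sum>x\<in>T. e x * c x z) = (\<Sum>x\<in>T - {x0}. d x * c' x z)" for z
    proof -
      have "(\<Sum>x\<in>T. e x * c x z) = e x0 * c x0 z + (\<Sum>x\<in>T - {x0}. e x * c x z)"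
        by (rule sum.remove[OF insert.prems(1) x0(1)])
      also have "(\<Sum>x\<in>T - {x0}. e x * c x z) = (\<Sum>x\<in>T - {x0}. d x * c x z)"
        by (intro sum.cong) (auto simp: e_def)
      also have "e x0 * c x0 z = - (\<Sum>x\<in>T - {x0}. d x * ((c x y / c x0 y) * c x0 z))"
        by (simp add: e_def sum_distrib_right mult.assoc)
      finally show ?thesis by (simp add: c'_def right_diff_distrib sum_subtractf)
    qed
    have "c' x y = 0" for x using x0 by (simp add: c'_def)
    then have "\<forall>z\<in>insert y Y. (\<Sum>x\<in>T. e x * c x z) = 0" using d(2) by (simp add: e)
    moreover have "\<exists>x\<in>T. e x \<noteq> 0" using d(1) by (auto simp: e_def)
    ultimately show ?thesis by blast
  qed
qed

lemma dependent_modulo_subspace: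
  fixes U Y :: "('n, 'k::field) mpoly set" and v :: "'x \<Rightarrow> ('n, 'k) mpoly"
  assumes U: "kv.subspace U" and "finite T" "finite Y" "card Y < card T"
    and v: "\<And>x. x \<in> T \<Longrightarrow> v x \<in> kv.span (U \<union> Y)"
  shows "\<exists>d. (\<exists>x\<in>T. d x \<noteq> 0) \<and> (\<Sum>x\<in>T. cmul (d x) (v x)) \<in> U"
proof -
  have "\<forall>x\<in>T. \<exists>uc. fst uc \<in> U \<and> v x = fst uc + (\<Sum>y\<in>Y. cmul (snd uc y) y)"
  proof
    fix x assume x: "x \<in> T"
    obtain u p where up: "u \<in> kv.span U" "p \<in> kv.span Y" "v x = u + p"
      using v[OF x] unfolding kv.span_Un by blast
    obtain c where c: "p = (\<Sum>y\<in>Y. cmul (c y) y)"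
      using up(2) unfolding kv.span_finite[OF assms(3)] by blast
    have "u \<in> U" using kv.span_minimal[OF order_refl U] up(1) by blast
    then show "\<exists>uc. fst uc \<in> U \<and> v x = fst uc + (\<Sum>y\<in>Y. cmul (snd uc y) y)"
      using up c by (intro exI[of _ "(u, c)"]) simp
  qed
  then obtain uc where "\<forall>x\<in>T. fst (uc x) \<in> U \<and> v x = fst (uc x) + (\<Sum>y\<in>Y. cmul (snd (uc x) y) y)"
    by (rule bchoice[THEN exE])
  moreover define u c where "u x = fst (uc x)" and "c x = snd (uc x)" for x
  ultimately have uc: "u x \<in> U" "v x = u x + (\<Sum>y\<in>Y. cmul (c x y) y)" if "x \<in> T" for x
    using that by simp_all
  obtain d where d: "\<exists>x\<in>T. d x \<noteq> 0" "\<forall>y\<in>Y. (\<Sum>x\<in>T. d x * c x y) = 0"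
    using underdetermined_system_solvable[OF assms(3,2,4), of c] by blast
  have "(\<Sum>x\<in>T. cmul (d x) (v x)) = (\<Sum>x\<in>T. cmul (d x) (u x))"
  proof (rule poly_mapping_eqI)
    fix s
    have "(\<Sum>x\<in>T. d x * (\<Sum>y\<in>Y. c x y * Poly_Mapping.lookup y s))
        = (\<Sum>y\<in>Y. \<Sum>x\<in>T. d x * (c x y * Poly_Mapping.lookup y s))"
      by (simp add: sum_distrib_left) (rule sum.swap)
    also have "\<dots> = (\<Sum>y\<in>Y. (\<Sum>x\<in>T. d x * c x y) * Poly_Mapping.lookup y s)"
      by (simp add: sum_distrib_right mult.assoc)
    also have "\<dots> = 0" using d(2) by simp
    finally show "Poly_Mapping.lookup (\<Sum>x\<in>T. cmul (d x) (v x)) s =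
        Poly_Mapping.lookup (\<Sum>x\<in>T. cmul (d x) (u x)) s"
      by (simp add: uc(2) lookup_sum lookup_add distrib_left sum.distrib)
  qed
  moreover have "(\<Sum>x\<in>T. cmul (d x) (u x)) \<in> U"
    by (intro kv.subspace_sum[OF U] kv.subspace_scale[OF U] uc(1))
  ultimately show ?thesis using d(1) by auto
qed

text \<open>
  If \<open>W\<close> reduces \<open>I\<close> at \<open>k\<close>, the monomials of degree at most \<open>k\<close> generate \<open>R/I\<close> as a module over the
  subalgebra generated by \<open>W\<close>. These products span the part of degree at most \<open>N\<close>, and their number
  grows like \<open>N ^ card W\<close>.
\<close>

definition bounded_products ::
  "('n::finite, 'k::field) mpoly set \<Rightarrow> nat \<Rightarrow> nat \<Rightarrow> ('n, 'k) mpoly set" where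
  "bounded_products W k N =
     (\<lambda>(a, \<beta>). xpow a * (\<Prod>w\<in>W. w ^ \<beta> w)) ` ({a. monom_degree a \<le> k} \<times> (\<Pi>\<^sub>E w\<in>W. {..N}))"

lemma finite_bounded_products: "finite W \<Longrightarrow> finite (bounded_products W k N)"
  unfolding bounded_products_def
  by (intro finite_imageI finite_cartesian_product finite_monom_degree_le finite_PiE) auto

lemma card_bounded_products:
  fixes W :: "('n::finite, 'k::field) mpoly set"
  assumes "finite W"
  shows "card (bounded_products W k N) \<le> card {a :: 'n monom. monom_degree a \<le> k} * Suc N ^ card W"
proof -
  have "card (bounded_products W k N) \<le> card ({a :: 'n monom. monom_degree a \<le> k} \<times> (\<Pi>\<^sub>E w\<in>W. {..N}))"
    unfolding bounded_products_def
    by (intro card_image_le finite_cartesian_product finite_monom_degree_le finite_PiE) (use assms in auto)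
  then show ?thesis using assms by (simp add: card_cartesian_product card_PiE)
qed

lemma mult_bounded_products:
  assumes "finite W" "w \<in> W" "p \<in> bounded_products W k N"
  shows "w * p \<in> bounded_products W k (Suc N)"
proof -
  obtain a \<beta> where p: "p = xpow a * (\<Prod>w\<in>W. w ^ \<beta> w)" "monom_degree a \<le> k" "\<beta> \<in> (\<Pi>\<^sub>E w\<in>W. {..N})"
    using assms(3) by (auto simp: bounded_products_def)
  define \<gamma> where "\<gamma> = \<beta>(w := Suc (\<beta> w))"
  have 1: "(\<Prod>w\<in>W. w ^ \<gamma> w) = w * (\<Prod>w\<in>W. w ^ \<beta> w)"
  proof -
    have "(\<Prod>x\<in>W - {w}. x ^ \<gamma> x) = (\<Prod>x\<in>W - {w}. x ^ \<beta> x)"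
      by (intro prod.cong) (auto simp: \<gamma>_def)
    then show ?thesis
      using prod.remove[OF assms(1,2), of "\<lambda>x. x ^ \<gamma> x"] prod.remove[OF assms(1,2), of "\<lambda>x. x ^ \<beta> x"]
      by (simp add: \<gamma>_def mult.assoc)
  qed
  have "\<beta> x \<le> N" if "x \<in> W" for x using p(3) that by (auto simp: PiE_iff)
  then have "\<gamma> \<in> (\<Pi>\<^sub>E w\<in>W. {..Suc N})"
    using p(3) assms(2) by (auto simp: \<gamma>_def PiE_iff extensional_def le_SucI)
  moreover have "w * p = xpow a * (\<Prod>w\<in>W. w ^ \<gamma> w)"
    unfolding 1 p(1) by (rule mult.left_commute)
  ultimately show ?thesis using p(2) by (auto simp: bounded_products_def)
qed

lemma xpow_in_bounded_products:
  fixes W :: "('n::finite, 'k::field) mpoly set"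
  assumes "monom_degree s \<le> k"
  shows "xpow s \<in> bounded_products W k N"
  unfolding bounded_products_def
proof (rule image_eqI)
  have "(\<Prod>w\<in>W. w ^ (\<lambda>w\<in>W. 0) w) = 1" by (intro prod.neutral) simp
  then show "xpow s = (case (s, \<lambda>w\<in>W. 0) of (a, \<beta>) \<Rightarrow> xpow a * (\<Prod>w\<in>W. w ^ \<beta> w))" by simp
qed (use assms in auto)

lemma xpow_in_span_bounded_products:
  fixes I W :: "('n::finite, 'k::field) mpoly set"
  assumes I: "homogeneous_ideal I" and W: "finite W" "\<And>w. w \<in> W \<Longrightarrow> homog 1 w"
    and red: "lin_reduces I W k"
  shows "monom_degree s \<le> N \<Longrightarrow> xpow s \<in> kv.span (I \<union> bounded_products W k N)"
proof (induction N arbitrary: s)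
  case 0
  then show ?case by (intro kv.span_base UnI2 xpow_in_bounded_products) simp
next
  case (Suc N)
  let ?T = "kv.span (I \<union> bounded_products W k (Suc N))"
  note I' = homogeneous_idealD(1)[OF I]
  show ?case
  proof (cases "monom_degree s \<le> k")
    case True
    then show ?thesis by (intro kv.span_base UnI2 xpow_in_bounded_products)
  next
    case False
    then have "monom_degree s = Suc k + (monom_degree s - Suc k)" by simp
    then obtain s1 s2 where s: "s = s1 + s2" "monom_degree s1 = Suc k"
      using monom_split[of s "Suc k" "monom_degree s - Suc k"] by blast
    have mult_w: "w * p \<in> ?T" if "p \<in> kv.span (I \<union> bounded_products W k N)" "w \<in> W" for w p
    proof -
      have "kv.subspace {p. w * p \<in> ?T}"
      proof (rule kv.subspaceI)
        fix c x assume "x \<in> {p. w * p \<in> ?T}"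
        then have "cmul c (w * x) \<in> ?T" by (intro kv.span_scale) simp
        then show "cmul c x \<in> {p. w * p \<in> ?T}" by (simp add: mult.left_commute)
      qed (simp_all add: kv.span_zero distrib_left kv.span_add)
      moreover have "I \<union> bounded_products W k N \<subseteq> {p. w * p \<in> ?T}"
        using mult_bounded_products[OF W(1) that(2)] idl.subspace_scale[OF I']
        by (auto intro: kv.span_base)
      ultimately have "kv.span (I \<union> bounded_products W k N) \<subseteq> {p. w * p \<in> ?T}"
        by (intro kv.span_minimal)
      then show ?thesis using that(1) by blast
    qed
    have "kv.subspace {p. xpow s2 * p \<in> ?T}"
    proof (rule kv.subspaceI)
      fix c x assume "x \<in> {p. xpow s2 * p \<in> ?T}"
      then have "cmul c (xpow s2 * x) \<in> ?T" by (intro kv.span_scale) simp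
      then show "cmul c x \<in> {p. xpow s2 * p \<in> ?T}" by (simp add: mult.left_commute)
    qed (simp_all add: kv.span_zero distrib_left kv.span_add)
    moreover have "{f \<in> I. homog (Suc k) f} \<union> monomial_multiples W k \<subseteq> {p. xpow s2 * p \<in> ?T}"
    proof -
      have "xpow s2 * (w * xpow t) \<in> ?T" if "w \<in> W" "monom_degree t = k" for w t
      proof -
        have "monom_degree (s2 + t) \<le> N" using Suc.prems s that by simp
        from mult_w[OF Suc.IH[OF this] that(1)] show ?thesis
          by (simp only: mult.left_commute[of _ w] xpow_mult)
      qed
      then show ?thesis
        using idl.subspace_scale[OF I'] by (auto simp: monomial_multiples_def intro: kv.span_base)
    qed
    ultimately have "kv.span ({f \<in> I. homog (Suc k) f} \<union> monomial_multiples W k) \<subseteq> {p. xpow s2 * p \<in> ?T}"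
      by (intro kv.span_minimal)
    then have "xpow s2 * xpow s1 \<in> ?T"
      using xpow_in_span_monomial_multiples[OF I W(2) red s(2)] by blast
    then show ?thesis by (simp add: s(1) xpow_mult add.commute)
  qed
qed

text \<open>
  The set \<open>S\<close> stands for the monomials outside an initial ideal \<open>U\<close> of \<open>I\<close>. The number of elements of
  \<open>S\<close> of degree at most \<open>e N\<close> is bounded from below by the number of monomials in \<open>W\<close> with all
  exponents at most \<open>N\<close>, which are independent modulo \<open>U\<close>, and from above by the size of a generating
  system of the same part of \<open>R/I\<close>. The bounds are polynomials in \<open>N\<close> of degree \<open>card W\<close> and \<open>card W'\<close>.
\<close>

lemma card_independent_le_card_generators:
  fixes I U W W' :: "('n::finite, 'k::field) mpoly set" and S :: "'n monom set"
  assumes I: "homogeneous_ideal I" and W': "finite W'" "\<And>w. w \<in> W' \<Longrightarrow> homog 1 w"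
    and red: "lin_reduces I W' k"
    and S: "\<And>T d. finite T \<Longrightarrow> T \<subseteq> S \<Longrightarrow> (\<Sum>s\<in>T. cmul (d s) (xpow s)) \<in> I \<Longrightarrow> \<forall>s\<in>T. d s = 0"
    and U: "kv.subspace U" "\<And>s. s \<notin> S \<Longrightarrow> xpow s \<in> U"
    and W: "finite W" "\<And>w. w \<in> W \<Longrightarrow> homog 1 w"
    and ind: "\<And>N d. (\<Sum>\<alpha>\<in>(\<Pi>\<^sub>E w\<in>W. {..N}). cmul (d \<alpha>) (\<Prod>w\<in>W. w ^ \<alpha> w)) \<in> U
      \<Longrightarrow> \<forall>\<alpha>\<in>(\<Pi>\<^sub>E w\<in>W. {..N}). d \<alpha> = 0"
  shows "card W \<le> card W'"
proof (rule ccontr)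
  assume less: "\<not> card W \<le> card W'"
  define e where "e = card W"
  define e' where "e' = card W'"
  define C where "C = card {a :: 'n monom. monom_degree a \<le> k}"
  have main: "Suc N ^ e \<le> C * Suc (e * N) ^ e'" for N
  proof -
    define T where "T = {s \<in> S. monom_degree s \<le> e * N}"
    have T: "finite T" "T \<subseteq> S"
      using finite_subset[OF _ finite_monom_degree_le[of "e * N"], of T] by (auto simp: T_def)
    let ?B = "\<Pi>\<^sub>E w\<in>W. {..N}"
    have finB: "finite ?B" using W(1) by (intro finite_PiE) auto
    have span: "(\<Prod>w\<in>W. w ^ \<alpha> w) \<in> kv.span (U \<union> xpow ` T)" if "\<alpha> \<in> ?B" for \<alpha>
    proof (rule in_subspace_if_monomials[OF kv.subspace_span])
      fix s assume "s \<in> Poly_Mapping.keys (\<Prod>w\<in>W. w ^ \<alpha> w)"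
      then have "monom_degree s = (\<Sum>w\<in>W. \<alpha> w)"
        using homog_prod_power[OF W(2)] by (auto simp: homog_def)
      also have "\<dots> \<le> e * N"
        using sum_bounded_above[of W \<alpha> N] that by (auto simp: e_def PiE_iff)
      finally show "xpow s \<in> kv.span (U \<union> xpow ` T)"
        using U(2) by (cases "s \<in> S") (auto simp: T_def intro: kv.span_base)
    qed
    have "\<not> card (xpow ` T :: ('n, 'k) mpoly set) < card ?B"
    proof
      assume "card (xpow ` T :: ('n, 'k) mpoly set) < card ?B"
      then obtain d where d: "\<exists>\<alpha>\<in>?B. d \<alpha> \<noteq> 0" "(\<Sum>\<alpha>\<in>?B. cmul (d \<alpha>) (\<Prod>w\<in>W. w ^ \<alpha> w)) \<in> U"
        using dependent_modulo_subspace[of U ?B "xpow ` T" "\<lambda>\<alpha>. \<Prod>w\<in>W. w ^ \<alpha> w",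
            OF U(1) finB _ _ span] T(1) by auto
      show False using ind[OF d(2)] d(1) by blast
    qed
    then have 1: "card ?B \<le> card T"
      using card_image_le[OF T(1), of "xpow :: _ \<Rightarrow> ('n, 'k) mpoly"] by linarith
    have span': "xpow s \<in> kv.span (I \<union> bounded_products W' k (e * N))" if "s \<in> T" for s
      using that by (intro xpow_in_span_bounded_products[OF I W' red]) (auto simp: T_def)
    have "\<not> card (bounded_products W' k (e * N)) < card T"
    proof
      assume "card (bounded_products W' k (e * N)) < card T"
      then obtain d where d: "\<exists>s\<in>T. d s \<noteq> 0" "(\<Sum>s\<in>T. cmul (d s) (xpow s)) \<in> I"
        using dependent_modulo_subspace[of I T "bounded_products W' k (e * N)" xpow,
          OF subspace_idl_imp_kv[OF homogeneous_idealD(1)[OF I]] T(1)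
          finite_bounded_products[OF W'(1)] _ span'] by blast
      show False using S[OF T d(2)] d(1) by blast
    qed
    then have "card T \<le> C * Suc (e * N) ^ e'"
      using card_bounded_products[OF W'(1), of k "e * N"] by (simp add: C_def e'_def)
    moreover have "card ?B = Suc N ^ e" using W(1) by (simp add: card_PiE e_def)
    ultimately show ?thesis using 1 by simp
  qed
  have e: "e' < e" "e > 0" using less by (auto simp: e_def e'_def)
  \<comment> \<open>At this \<open>N\<close> the bounds contradict each other if \<open>e' < e\<close>.\<close>
  define N where "N = C * e ^ e'"
  have "Suc N ^ Suc e' \<le> Suc N ^ e" using e by (intro power_increasing) auto
  also have "\<dots> \<le> C * Suc (e * N) ^ e'" by (rule main)
  also have "\<dots> \<le> C * (e * Suc N) ^ e'" using e by (intro mult_left_mono power_mono) auto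
  also have "\<dots> = N * Suc N ^ e'" by (simp only: N_def power_mult_distrib mult.assoc)
  finally show False by simp
qed

section \<open>Generic determinants\<close>

lemma det_nonzero_if_rows_independent:
  fixes A :: "nat \<Rightarrow> nat \<Rightarrow> 'k::field"
  assumes "\<And>d. (\<And>j. j < N \<Longrightarrow> (\<Sum>i<N. d i * A i j) = 0) \<Longrightarrow> \<forall>i<N. d i = 0"
  shows "det (mat N N (\<lambda>(i, j). A i j)) \<noteq> 0"
proof
  let ?A = "mat N N (\<lambda>(i, j). A i j)"
  have carr: "?A \<in> carrier_mat N N" by simp
  assume "det ?A = 0"
  then have "det (transpose_mat ?A) = 0" using det_transpose[OF carr] by simp
  moreover have carrT: "transpose_mat ?A \<in> carrier_mat N N" by simp
  ultimately obtain v where v: "v \<in> carrier_vec N" "v \<noteq> 0\<^sub>v N" "transpose_mat ?A *\<^sub>v v = 0\<^sub>v N"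
    using det_0_iff_vec_prod_zero_field[OF carrT] by blast
  have "(\<Sum>i<N. v $ i * A i j) = 0" if "j < N" for j
  proof -
    have "(transpose_mat ?A *\<^sub>v v) $ j = (\<Sum>i<N. A i j * v $ i)"
      using that v(1) by (simp add: mult_mat_vec_def scalar_prod_def lessThan_atLeast0)
    moreover have "(transpose_mat ?A *\<^sub>v v) $ j = 0" using v(3) that by simp
    ultimately show ?thesis by (simp add: mult.commute)
  qed
  then have "\<forall>i<N. v $ i = 0" by (rule assms)
  then have "v = 0\<^sub>v N" using v(1) by (intro eq_vecI) auto
  with v(2) show False by simp
qed

text \<open>
  The coefficients are the entries of a row of the inverse matrix, taken from the adjugate.
\<close>

lemma unit_vectors_in_row_space:
  fixes A :: "nat \<Rightarrow> nat \<Rightarrow> 'k::field"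
  assumes det: "det (mat N N (\<lambda>(i, j). A i j)) \<noteq> 0" and l: "l < N"
  obtains d where "\<And>j. j < N \<Longrightarrow> (\<Sum>i<N. d i * A i j) = (if j = l then 1 else 0)"
proof
  let ?A = "mat N N (\<lambda>(i, j). A i j)"
  have carr: "?A \<in> carrier_mat N N" by simp
  note adj = adj_mat[OF carr]
  fix j assume j: "j < N"
  have "(adj_mat ?A * ?A) $$ (l, j) = (\<Sum>i<N. adj_mat ?A $$ (l, i) * A i j)"
    using adj(1) l j by (simp add: scalar_prod_def lessThan_atLeast0)
  moreover have "(adj_mat ?A * ?A) $$ (l, j) = (if j = l then det ?A else 0)"
    unfolding adj(3) using l j by simp
  ultimately have "(\<Sum>i<N. adj_mat ?A $$ (l, i) * A i j) = (if j = l then det ?A else 0)" by simp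
  then have "(\<Sum>i<N. adj_mat ?A $$ (l, i) * A i j) / det ?A = (if j = l then 1 else 0)"
    using det by simp
  then show "(\<Sum>i<N. (adj_mat ?A $$ (l, i) / det ?A) * A i j) = (if j = l then 1 else 0)"
    by (simp add: sum_divide_distrib)
qed

text \<open>
  The index \<open>j\<close> stands for a monomial with exponent \<open>m j\<close>. In the Leibniz formula for the deformed matrix, a
  permutation \<open>p\<close> contributes a multiple of the power of \<open>y\<close> whose exponent is the sum of \<open>m (p i)\<close> over \<open>i \<notin> S\<close>.
  By the hypothesis on \<open>p\<close>, a nonzero contribution with the same exponent as the identity fixes \<open>S\<close>
  pointwise, and then it agrees with the contribution of \<open>p\<close> to the determinant of the matrix whose
  rows in \<open>S\<close> are unit vectors. So that determinant is a coefficient of the polynomial function.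
\<close>

lemma det_deformation:
  fixes c f :: "nat \<Rightarrow> nat \<Rightarrow> 'k::field" and m :: "nat \<Rightarrow> 'n::finite \<Rightarrow> nat"
  assumes inf: "infinite (UNIV :: 'k set)" and S: "S \<subseteq> {..<N}"
    and f1: "\<And>i. i \<in> S \<Longrightarrow> f i i = 1"
    and key: "\<And>p. p permutes {..<N} \<Longrightarrow> (\<And>i. i \<in> S \<Longrightarrow> f i (p i) \<noteq> 0) \<Longrightarrow>
       (\<And>x. (\<Sum>i\<in>{..<N} - S. m (p i) x) = (\<Sum>i\<in>{..<N} - S. m i x)) \<Longrightarrow> \<forall>i\<in>S. p i = i"
    and det: "det (mat N N (\<lambda>(i, j). if i \<in> S then (if i = j then 1 else 0) else c i j)) \<noteq> 0"
  obtains y where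
    "det (mat N N (\<lambda>(i, j). if i \<in> S then f i j else c i j * (\<Prod>x\<in>UNIV. y x ^ m j x))) \<noteq> 0"
proof -
  let ?P = "{p. p permutes {..<N}}"
  define E where "E p x = (\<Sum>i\<in>{..<N} - S. m (p i) x)" for p x
  define C where "C p = signof p * (\<Prod>i<N. if i \<in> S then f i (p i) else c i (p i))" for p
  define C0 where
    "C0 p = signof p * (\<Prod>i<N. if i \<in> S then (if i = p i then 1 else 0) else c i (p i))" for p
  have finP: "finite ?P" by (rule finite_permutations) simp
  have less: "p i < N" if "p permutes {..<N}" "i < N" for p i
    using permutes_in_image[OF that(1), of i] that(2) by simp
  have det0: "det (mat N N (\<lambda>(i, j). if i \<in> S then (if i = j then 1 else 0) else c i j)) = (\<Sum>p\<in>?P. C0 p)"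
    by (subst det_def'[of _ N])
       (auto simp: C0_def less lessThan_atLeast0[symmetric] intro!: sum.cong prod.cong)
  have dety: "det (mat N N (\<lambda>(i, j). if i \<in> S then f i j else c i j * (\<Prod>x\<in>UNIV. y x ^ m j x)))
      = (\<Sum>p\<in>?P. C p * (\<Prod>x\<in>UNIV. y x ^ E p x))" for y
  proof -
    have "(\<Prod>i<N. if i \<in> S then f i (p i) else c i (p i) * (\<Prod>x\<in>UNIV. y x ^ m (p i) x))
        = (\<Prod>i<N. if i \<in> S then f i (p i) else c i (p i)) * (\<Prod>x\<in>UNIV. y x ^ E p x)" for p
    proof -
      have "(\<Prod>i<N. if i \<in> S then f i (p i) else c i (p i) * (\<Prod>x\<in>UNIV. y x ^ m (p i) x))
        = (\<Prod>i<N. (if i \<in> S then f i (p i) else c i (p i)) *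
            (if i \<in> {..<N} - S then \<Prod>x\<in>UNIV. y x ^ m (p i) x else 1))"
        by (intro prod.cong) auto
      also have "\<dots> = (\<Prod>i<N. if i \<in> S then f i (p i) else c i (p i)) *
          (\<Prod>i<N. if i \<in> {..<N} - S then \<Prod>x\<in>UNIV. y x ^ m (p i) x else 1)"
        by (rule prod.distrib)
      also have "(\<Prod>i<N. if i \<in> {..<N} - S then \<Prod>x\<in>UNIV. y x ^ m (p i) x else 1)
          = (\<Prod>i\<in>{..<N} - S. \<Prod>x\<in>UNIV. y x ^ m (p i) x)"
        by (rule prod.mono_neutral_cong_right) auto
      also have "\<dots> = (\<Prod>x\<in>UNIV. \<Prod>i\<in>{..<N} - S. y x ^ m (p i) x)" by (rule prod.swap)
      finally show ?thesis by (simp only: E_def power_sum)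
    qed
    then show ?thesis
      by (subst det_def'[of _ N])
         (auto simp: C_def less lessThan_atLeast0[symmetric] mult.assoc intro!: sum.cong prod.cong)
  qed
  have C_eq: "(if \<forall>x. E p x = E id x then C p else 0) = C0 p" if p: "p permutes {..<N}" for p
  proof (cases "\<forall>i\<in>S. p i = i")
    case True
    have "E p x = E id x" for x
    proof -
      have eq: "(\<Sum>i<N. m (p i) x) = (\<Sum>i<N. m i x)"
        using sum.permute[OF p, of "\<lambda>i. m i x"] by (simp add: comp_def)
      have "(\<Sum>i<N. m (p i) x) = E p x + (\<Sum>i\<in>S. m (p i) x)" "(\<Sum>i<N. m i x) = E id x + (\<Sum>i\<in>S. m i x)"
        unfolding E_def id_apply by (rule sum.subset_diff[OF S], simp)+
      moreover have "(\<Sum>i\<in>S. m (p i) x) = (\<Sum>i\<in>S. m i x)" using True by (intro sum.cong) simp_all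
      ultimately show ?thesis using eq by simp
    qed
    moreover have "C p = C0 p"
      unfolding C_def C0_def using True f1 by (intro arg_cong2[of _ _ _ _ "(*)"] prod.cong) auto
    ultimately show ?thesis by simp
  next
    case False
    then obtain i where i: "i \<in> S" "i \<noteq> p i" by metis
    then have "C0 p = 0" using S by (auto simp: C0_def intro!: prod_zero bexI[of _ i])
    moreover have "C p = 0" if "\<forall>x. E p x = E id x"
    proof -
      have "\<exists>j\<in>S. f j (p j) = 0"
      proof (rule ccontr)
        assume "\<not> ?thesis"
        then have "\<forall>i\<in>S. p i = i" using that by (intro key[OF p]) (auto simp: E_def)
        with False show False by blast
      qed
      then obtain j where "j \<in> S" "f j (p j) = 0" by blast
      then show ?thesis using S by (auto simp: C_def intro!: prod_zero bexI[of _ j])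
    qed
    ultimately show ?thesis by simp
  qed
  have "(\<Sum>p\<in>{p \<in> ?P. \<forall>x\<in>UNIV. E p x = E id x}. C p) = (\<Sum>p\<in>?P. C0 p)"
    using C_eq by (subst sum.inter_filter[OF finP]) (intro sum.cong, auto)
  then have "(\<Sum>p\<in>{p \<in> ?P. \<forall>x\<in>UNIV. E p x = E id x}. C p) \<noteq> 0" using det det0 by simp
  then have "\<exists>y. (\<Sum>p\<in>?P. C p * (\<Prod>x\<in>UNIV. y x ^ E p x)) \<noteq> 0"
    using sum_coeffs_zero_if_poly_fun_zero[OF inf _ finP, of UNIV C E "E id"] by auto
  then show thesis using dety that by metis
qed

section \<open>Term orders and initial ideals\<close>

lemma term_orderD:
  assumes "term_order \<tau>"
  shows "(s, s) \<in> \<tau>" "(s, t) \<in> \<tau> \<Longrightarrow> (t, u) \<in> \<tau> \<Longrightarrow> (s, u) \<in> \<tau>"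
    "(s, t) \<in> \<tau> \<Longrightarrow> (t, s) \<in> \<tau> \<Longrightarrow> s = t" "(s, t) \<in> \<tau> \<or> (t, s) \<in> \<tau>"
    "(s, t) \<in> \<tau> \<Longrightarrow> (s + u, t + u) \<in> \<tau>"
proof -
  have lin: "linear_order \<tau>" using assms by (simp add: term_order_def)
  then have refl: "refl \<tau>" and tr: "trans \<tau>" and anti: "antisym \<tau>" and tot: "total \<tau>"
    by (auto simp: linear_order_on_def partial_order_on_def preorder_on_def)
  show *: "(s, s) \<in> \<tau>" for s using refl by (simp add: refl_on_def)
  show "(s, t) \<in> \<tau> \<Longrightarrow> (t, u) \<in> \<tau> \<Longrightarrow> (s, u) \<in> \<tau>" using tr by (rule transD)
  show "(s, t) \<in> \<tau> \<Longrightarrow> (t, s) \<in> \<tau> \<Longrightarrow> s = t" using anti by (rule antisymD)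
  show "(s, t) \<in> \<tau> \<or> (t, s) \<in> \<tau>" using tot * by (cases "s = t") (auto simp: total_on_def)
  show "(s, t) \<in> \<tau> \<Longrightarrow> (s + u, t + u) \<in> \<tau>" using assms by (simp add: term_order_def)
qed

text \<open>
  The second half is what makes the exponent of the identity permutation occur only once.
\<close>

lemma term_order_sum_rigid:
  assumes \<tau>: "term_order \<tau>" and "finite S" and "\<And>i. i \<in> S \<Longrightarrow> (a i, b i) \<in> \<tau>"
  shows "((\<Sum>i\<in>S. a i), (\<Sum>i\<in>S. b i)) \<in> \<tau> \<and> ((\<Sum>i\<in>S. a i) = (\<Sum>i\<in>S. b i) \<longrightarrow> (\<forall>i\<in>S. a i = b i))"
  using assms(2,3)
proof (induction S rule: finite_induct)
  case empty
  then show ?case using term_orderD(1)[OF \<tau>] by simp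
next
  case (insert i S)
  let ?a = "\<Sum>i\<in>S. a i" and ?b = "\<Sum>i\<in>S. b i"
  have "(?a, ?b) \<in> \<tau> \<and> (?a = ?b \<longrightarrow> (\<forall>i\<in>S. a i = b i))"
    by (rule insert.IH) (rule insert.prems, rule insertI2)
  then have IH: "(?a, ?b) \<in> \<tau>" "?a = ?b \<Longrightarrow> \<forall>i\<in>S. a i = b i" by blast+
  have 1: "(a i + ?a, b i + ?a) \<in> \<tau>" using insert.prems term_orderD(5)[OF \<tau>] by simp
  have 2: "(b i + ?a, b i + ?b) \<in> \<tau>"
    using term_orderD(5)[OF \<tau> IH(1), of "b i"] by (simp add: add.commute)
  have "\<forall>j\<in>insert i S. a j = b j" if eq: "a i + ?a = b i + ?b"
  proof -
    have "a i + ?a = b i + ?a" using term_orderD(3)[OF \<tau> 1] 2 unfolding eq[symmetric] by blast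
    then have ab: "a i = b i" by (rule add_right_imp_eq)
    have "?a = ?b" using eq unfolding ab by (rule add_left_imp_eq)
    from IH(2)[OF this] ab show ?thesis by blast
  qed
  then show ?case
    unfolding sum.insert[OF insert.hyps] using term_orderD(2)[OF \<tau> 1 2] by blast
qed

lemma term_order_finite_max:
  assumes \<tau>: "term_order \<tau>" and "finite A" "A \<noteq> {}"
  shows "\<exists>s\<in>A. \<forall>t\<in>A. (t, s) \<in> \<tau>"
  using assms(2,3)
proof (induction A rule: finite_ne_induct)
  case (singleton a)
  then show ?case using term_orderD(1)[OF \<tau>] by simp
next
  case (insert a A)
  then obtain s where s: "s \<in> A" "\<forall>t\<in>A. (t, s) \<in> \<tau>" by blast
  consider "(a, s) \<in> \<tau>" | "(s, a) \<in> \<tau>" using term_orderD(4)[OF \<tau>] by blast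
  then show ?case
  proof cases
    case 1
    then show ?thesis using s by blast
  next
    case 2
    then have "(t, a) \<in> \<tau>" if "t \<in> A" for t using s(2) that term_orderD(2)[OF \<tau>] by blast
    then show ?thesis using term_orderD(1)[OF \<tau>, of a] by blast
  qed
qed

definition leading_monoms :: "'n monom rel \<Rightarrow> ('n, 'k::comm_ring_1) mpoly set \<Rightarrow> 'n monom set" where
  "leading_monoms \<tau> I = {s. \<exists>f\<in>I. f \<noteq> 0 \<and> is_leading_monom \<tau> f s}"

lemma leading_monoms_add:
  fixes I :: "('n::finite, 'k::field) mpoly set"
  assumes \<tau>: "term_order \<tau>" and I: "idl.subspace I" and s: "s \<in> leading_monoms \<tau> I"
  shows "s + t \<in> leading_monoms \<tau> I"
proof -
  obtain f where f: "f \<in> I" "is_leading_monom \<tau> f s" using s by (auto simp: leading_monoms_def)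
  have "f * xpow t \<in> I" using idl.subspace_scale[OF I f(1), of "xpow t"] by (simp add: mult.commute)
  moreover have key: "s + t \<in> Poly_Mapping.keys (f * xpow t)"
    using f(2) by (simp add: is_leading_monom_def in_keys_iff lookup_mult_xpow)
  moreover have "(u, s + t) \<in> \<tau>" if u: "u \<in> Poly_Mapping.keys (f * xpow t)" for u
  proof -
    have "\<exists>b. u = b + t"
      using u lookup_mult_xpow_eq_0[of u t f] unfolding in_keys_iff by blast
    then obtain b where b: "u = b + t" by blast
    then have "b \<in> Poly_Mapping.keys f" using u by (simp add: in_keys_iff lookup_mult_xpow)
    then show ?thesis using f(2) term_orderD(5)[OF \<tau>] by (simp add: b is_leading_monom_def)
  qed
  moreover have "f * xpow t \<noteq> 0" using key by auto
  ultimately show ?thesis unfolding leading_monoms_def is_leading_monom_def by blast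
qed

text \<open>
  The leading monomials are closed under multiplication by monomials, so the ideal
  that they generate is already spanned by them as a vector space.
\<close>

lemma mem_initial_ideal_iff:
  fixes I :: "('n::finite, 'k::field) mpoly set"
  assumes \<tau>: "term_order \<tau>" and I: "idl.subspace I"
  shows "p \<in> initial_ideal \<tau> I \<longleftrightarrow> Poly_Mapping.keys p \<subseteq> leading_monoms \<tau> I"
proof -
  let ?G = "{xpow s | s. \<exists>f\<in>I. f \<noteq> 0 \<and> is_leading_monom \<tau> f s} :: ('n, 'k) mpoly set"
  let ?L = "{p. Poly_Mapping.keys p \<subseteq> leading_monoms \<tau> I} :: ('n, 'k) mpoly set"
  have eq: "initial_ideal \<tau> I = idl.span ?G"
    by (simp add: initial_ideal_def genideal_poly_ring)
  have "idl.subspace ?L"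
  proof (rule idl.subspaceI)
    fix x y assume "x \<in> ?L" "y \<in> ?L"
    then show "x + y \<in> ?L" using keys_add[of x y] by blast
  next
    fix c x assume x: "x \<in> ?L"
    have "a + b \<in> leading_monoms \<tau> I" if "b \<in> Poly_Mapping.keys x" for a b
      using leading_monoms_add[OF \<tau> I, of b a] x that by (auto simp: add.commute)
    then show "c * x \<in> ?L" using keys_mult[of c x] by blast
  qed simp
  moreover have "?G \<subseteq> ?L" by (auto simp: leading_monoms_def)
  ultimately have "initial_ideal \<tau> I \<subseteq> ?L" unfolding eq by (intro idl.span_minimal)
  moreover have "p \<in> initial_ideal \<tau> I" if "p \<in> ?L" for p
    unfolding eq
  proof (rule in_subspace_if_monomials[OF subspace_idl_imp_kv[OF idl.subspace_span]])
    fix s assume "s \<in> Poly_Mapping.keys p"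
    then have "s \<in> leading_monoms \<tau> I" using that by blast
    then show "xpow s \<in> idl.span ?G" by (intro idl.span_base) (auto simp: leading_monoms_def)
  qed
  ultimately show ?thesis by blast
qed

lemma homogeneous_initial_ideal:
  fixes I :: "('n::finite, 'k::field) mpoly set"
  assumes \<tau>: "term_order \<tau>" and I: "idl.subspace I"
  shows "homogeneous_ideal (initial_ideal \<tau> I)"
  unfolding homogeneous_ideal_def ideal_poly_ring_iff
proof (intro conjI ballI allI)
  show "idl.subspace (initial_ideal \<tau> I)" by (simp add: initial_ideal_def genideal_poly_ring)
  fix f d assume "f \<in> initial_ideal \<tau> I"
  then have "Poly_Mapping.keys f \<subseteq> leading_monoms \<tau> I" by (simp add: mem_initial_ideal_iff[OF \<tau> I])
  moreover have "Poly_Mapping.keys (hom_component d f) \<subseteq> Poly_Mapping.keys f"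
    by (auto simp: in_keys_iff split: if_splits)
  ultimately show "hom_component d f \<in> initial_ideal \<tau> I"
    by (simp add: mem_initial_ideal_iff[OF \<tau> I])
qed

lemma proper_homogeneous_ideal_subset:
  fixes I :: "('n::finite, 'k::field) mpoly set"
  assumes I: "homogeneous_ideal I" and "I \<noteq> UNIV"
  shows "I \<subseteq> tail_ideal 1"
proof
  fix f assume f: "f \<in> I"
  have "Poly_Mapping.lookup f 0 = 0"
  proof (rule ccontr)
    assume nz: "Poly_Mapping.lookup f 0 \<noteq> 0"
    have "cmul (inverse (Poly_Mapping.lookup f 0)) (hom_component 0 f) \<in> I"
      by (intro idl.subspace_scale homogeneous_idealD[OF I] f)
    moreover have "cmul (inverse (Poly_Mapping.lookup f 0)) (hom_component 0 f) = 1"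
      using nz by (intro poly_mapping_eqI) (auto simp: lookup_one when_def)
    ultimately have "1 \<in> I" by simp
    then have "x \<in> I" for x using idl.subspace_scale[OF homogeneous_idealD(1)[OF I], of 1 x] by simp
    with assms(2) show False by blast
  qed
  then show "f \<in> tail_ideal 1" by (simp add: tail_ideal_altdef)
qed

lemma initial_ideal_subset:
  fixes I :: "('n::finite, 'k::field) mpoly set"
  assumes \<tau>: "term_order \<tau>" and I: "idl.subspace I" "I \<subseteq> tail_ideal 1"
  shows "initial_ideal \<tau> I \<subseteq> tail_ideal 1"
proof
  fix p assume "p \<in> initial_ideal \<tau> I"
  then have p: "Poly_Mapping.keys p \<subseteq> leading_monoms \<tau> I" by (simp add: mem_initial_ideal_iff[OF \<tau> I(1)])
  have "0 \<notin> leading_monoms \<tau> I"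
  proof
    assume "0 \<in> leading_monoms \<tau> I"
    then obtain f where "f \<in> I" "0 \<in> Poly_Mapping.keys f"
      by (auto simp: leading_monoms_def is_leading_monom_def)
    moreover from this have "f \<in> tail_ideal 1" using I(2) by blast
    then have "Poly_Mapping.lookup f 0 = 0" by (simp add: tail_ideal_altdef)
    ultimately show False by (simp add: in_keys_iff)
  qed
  then have "monom_degree s \<noteq> 0" if "s \<in> Poly_Mapping.keys p" for s
    using p that unfolding monom_degree_eq_0 by blast
  then have "1 \<le> monom_degree s" if "s \<in> Poly_Mapping.keys p" for s
    using that by (simp only: One_nat_def Suc_le_eq neq0_conv)
  then show "p \<in> tail_ideal 1" unfolding tail_ideal_def by blast
qed

text \<open>
  Passing to the component of the degree of \<open>s\<close> keeps the leading monomial, because removing other terms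
  cannot create larger ones.
\<close>

lemma homogeneous_monic_leading:
  fixes I :: "('n::finite, 'k::field) mpoly set"
  assumes I: "homogeneous_ideal I" and s: "s \<in> leading_monoms \<tau> I"
  shows "\<exists>f\<in>I. homog (monom_degree s) f \<and> Poly_Mapping.lookup f s = 1 \<and>
    (\<forall>t\<in>Poly_Mapping.keys f. (t, s) \<in> \<tau>)"
proof -
  obtain f where f: "f \<in> I" "s \<in> Poly_Mapping.keys f" "\<forall>t\<in>Poly_Mapping.keys f. (t, s) \<in> \<tau>"
    using s by (auto simp: leading_monoms_def is_leading_monom_def)
  let ?g = "cmul (inverse (Poly_Mapping.lookup f s)) (hom_component (monom_degree s) f)"
  have "?g \<in> I" by (intro idl.subspace_scale homogeneous_idealD[OF I] f)
  moreover have "homog (monom_degree s) ?g" by (intro homog_cmul homog_hom_component)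
  moreover have "Poly_Mapping.lookup ?g s = 1" using f(2) by (simp add: in_keys_iff)
  moreover have "Poly_Mapping.keys ?g \<subseteq> Poly_Mapping.keys f"
    by (auto simp: in_keys_iff split: if_splits)
  then have "\<forall>t\<in>Poly_Mapping.keys ?g. (t, s) \<in> \<tau>" using f(3) by blast
  ultimately show ?thesis by blast
qed

section \<open>Rescaling the variables\<close>

lemma xpow_eq_iff: "(xpow s :: ('n, 'k::field) mpoly) = xpow t \<longleftrightarrow> s = t"
proof
  assume "(xpow s :: ('n, 'k) mpoly) = xpow t"
  then have "Poly_Mapping.keys (xpow s :: ('n, 'k) mpoly) = Poly_Mapping.keys (xpow t :: ('n, 'k) mpoly)"
    by (rule arg_cong)
  then show "s = t" by simp
qed simp

lemma independent_monomials: "kv.independent (range xpow :: ('n, 'k::field) mpoly set)"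
  unfolding kv.independent_explicit_module
proof (intro allI impI)
  fix t u and v :: "('n, 'k) mpoly"
  assume t: "finite t" "t \<subseteq> range xpow" "(\<Sum>v\<in>t. cmul (u v) v) = 0" "v \<in> t"
  obtain s where s: "v = xpow s" using t by blast
  have "Poly_Mapping.lookup v' s = (if v' = v then 1 else 0)" if "v' \<in> t" for v'
  proof -
    obtain s' where "v' = xpow s'" using t(2) \<open>v' \<in> t\<close> by blast
    then show ?thesis by (auto simp: s lookup_single when_def xpow_eq_iff)
  qed
  then have "(\<Sum>v'\<in>t. u v' * Poly_Mapping.lookup v' s) = (\<Sum>v'\<in>t. if v' = v then u v' else 0)"
    by (intro sum.cong) auto
  also have "\<dots> = u v" using t by simp
  also have "(\<Sum>v'\<in>t. u v' * Poly_Mapping.lookup v' s) = Poly_Mapping.lookup (\<Sum>v\<in>t. cmul (u v) v) s"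
    by (simp add: lookup_sum)
  finally show "u v = 0" using t(3) by simp
qed

text \<open>
  The substitution \<open>x\<^sub>i \<mapsto> y\<^sub>i x\<^sub>i\<close>, defined on coefficients.
\<close>

definition torus_scale :: "('n \<Rightarrow> 'k) \<Rightarrow> ('n::finite, 'k::field) mpoly \<Rightarrow> ('n, 'k) mpoly" where
  "torus_scale y p = (\<Sum>s\<in>Poly_Mapping.keys p.
     cmul ((\<Prod>x\<in>UNIV. y x ^ Poly_Mapping.lookup s x) * Poly_Mapping.lookup p s) (xpow s))"

lemma lookup_torus_scale:
  "Poly_Mapping.lookup (torus_scale y p) s = (\<Prod>x\<in>UNIV. y x ^ Poly_Mapping.lookup s x) * Poly_Mapping.lookup p s"
  by (auto simp: torus_scale_def lookup_sum lookup_single when_def in_keys_iff if_distrib[of "(*) _"] cong: if_cong)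

lemma homog_torus_scale: "homog d p \<Longrightarrow> homog d (torus_scale y p)"
  by (simp add: homog_altdef lookup_torus_scale)

lemma torus_scale_mult_xpow:
  "torus_scale y (p * xpow a) = cmul (\<Prod>x\<in>UNIV. y x ^ Poly_Mapping.lookup a x) (torus_scale y p * xpow a)"
proof (rule poly_mapping_eqI)
  fix v
  show "Poly_Mapping.lookup (torus_scale y (p * xpow a)) v =
    Poly_Mapping.lookup (cmul (\<Prod>x\<in>UNIV. y x ^ Poly_Mapping.lookup a x) (torus_scale y p * xpow a)) v"
  proof (cases "\<exists>b. v = b + a")
    case True
    then obtain b where v: "v = b + a" by blast
    show ?thesis
      unfolding v lookup_cmul lookup_torus_scale lookup_mult_xpow lookup_add power_add prod.distrib
      by (simp only: mult_ac)
  next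
    case False
    then have "Poly_Mapping.lookup (p * xpow a) v = 0" "Poly_Mapping.lookup (torus_scale y p * xpow a) v = 0"
      by (blast intro: lookup_mult_xpow_eq_0)+
    then show ?thesis by (simp only: lookup_cmul lookup_torus_scale mult_zero_right)
  qed
qed

section \<open>Deformation from the initial ideal\<close>

text \<open>
  The monomials of degree \<open>k + 1\<close> are enumerated as \<open>e 0, \<dots>, e (N - 1)\<close>. The basis \<open>B\<close> contains the
  monomials of the initial ideal, at the positions in \<open>S\<close>, and otherwise products of a form in \<open>W\<close> with a
  monomial. Rescaling such a product multiplies the coefficient of \<open>e j\<close> by the power of
  \<open>y\<close> with exponent \<open>e j\<close>, while replacing a leading monomial \<open>s\<close> by an element \<open>F s\<close> of \<open>I\<close> only brings
  in smaller monomials. This is the situation of \<open>det_deformation\<close>.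
\<close>

lemma lin_reduces_deformation:
  fixes I W :: "('n::finite, 'k::field) mpoly set"
  assumes inf: "infinite (UNIV :: 'k set)" and \<tau>: "term_order \<tau>" and I: "homogeneous_ideal I"
    and W: "finite W" "\<And>w. w \<in> W \<Longrightarrow> homog 1 w" and red: "lin_reduces (initial_ideal \<tau> I) W k"
  obtains W' where "finite W'" "\<forall>w\<in>W'. homog 1 w" "card W' \<le> card W" "lin_reduces I W' k"
proof -
  note I' = homogeneous_idealD(1)[OF I]
  define M where "M = {s :: 'n monom. monom_degree s = Suc k}"
  define LM where "LM = leading_monoms \<tau> I"
  define N where "N = card M"
  have finM: "finite M" unfolding M_def by (rule finite_monom_degree_eq)
  have injx: "inj_on (xpow :: _ \<Rightarrow> ('n, 'k) mpoly) A" for A by (simp add: inj_on_def xpow_eq_iff)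
  define S0 where "S0 = (xpow ` (M \<inter> LM) :: ('n, 'k) mpoly set)"
  have ind_mono: "kv.independent (xpow ` A :: ('n, 'k) mpoly set)" for A
    by (rule kv.independent_mono[OF independent_monomials]) blast
  obtain B where B: "S0 \<subseteq> B" "B \<subseteq> S0 \<union> monomial_multiples W k" "kv.independent B" "S0 \<union> monomial_multiples W k \<subseteq> kv.span B"
    using kv.maximal_independent_subset_extend[of S0 "S0 \<union> monomial_multiples W k"] ind_mono unfolding S0_def by blast
  have homprods: "homog (Suc k) (w * xpow t)" if "homog 1 w" "monom_degree t = k" for w and t :: "'n monom"
    using homog_mult[OF that(1), of k "xpow t"] that(2) by simp
  have homB: "homog (Suc k) b" if "b \<in> B" for b
  proof -
    have "b \<in> S0 \<or> b \<in> monomial_multiples W k" using B(2) that by blast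
    then show ?thesis
      using homprods[OF W(2)] by (auto simp: S0_def M_def monomial_multiples_def)
  qed
  have spanM: "xpow u \<in> kv.span B" if "u \<in> M" for u
  proof -
    have "f \<in> kv.span B" if "f \<in> initial_ideal \<tau> I" "homog (Suc k) f" for f
    proof (rule in_subspace_if_monomials[OF kv.subspace_span])
      fix s assume "s \<in> Poly_Mapping.keys f"
      then have "s \<in> M \<inter> LM"
        using that by (auto simp: mem_initial_ideal_iff[OF \<tau> I'] LM_def M_def homog_def)
      then show "xpow s \<in> kv.span B" using B(1) by (intro kv.span_base) (auto simp: S0_def)
    qed
    then have "kv.span ({f \<in> initial_ideal \<tau> I. homog (Suc k) f} \<union> monomial_multiples W k) \<subseteq> kv.span B"
      using B(4) by (intro kv.span_minimal kv.subspace_span) auto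
    moreover have "monom_degree u = Suc k" using that by (simp add: M_def)
    ultimately show ?thesis
      using xpow_in_span_monomial_multiples[OF homogeneous_initial_ideal[OF \<tau> I'] W(2) red] by blast
  qed
  have B_sub: "B \<subseteq> kv.span (xpow ` M)"
  proof
    fix b assume "b \<in> B"
    then have "s \<in> M" if "s \<in> Poly_Mapping.keys b" for s
      using homB that by (simp add: homog_def M_def)
    then show "b \<in> kv.span (xpow ` M)"
      by (intro in_subspace_if_monomials[OF kv.subspace_span kv.span_base] imageI)
  qed
  have finB: "finite B" and "card B \<le> card (xpow ` M :: ('n, 'k) mpoly set)"
    using kv.independent_span_bound[OF finite_imageI[OF finM] B(3) B_sub] by auto
  moreover have "card (xpow ` M :: ('n, 'k) mpoly set) \<le> card B"
    using kv.independent_span_bound[OF finB ind_mono[of M]] spanM by auto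
  moreover have "card (xpow ` M :: ('n, 'k) mpoly set) = N" by (simp add: N_def card_image[OF injx])
  ultimately have cardB: "card B = N" by simp
  have cardS0: "card S0 = card (M \<inter> LM)" by (simp add: S0_def card_image[OF injx])
  have "finite S0" using finB B(1) finite_subset by blast
  then have "card (B - S0) = N - card (M \<inter> LM)" using B(1) by (simp add: card_Diff_subset cardB cardS0)
  also have "\<dots> = card (M - LM)" unfolding N_def using card_Diff_subset_Int[of M LM] finM by simp
  finally obtain g where g: "bij_betw g (M - LM) (B - S0)"
    using finite_same_card_bij[of "M - LM" "B - S0"] finM finB by auto
  have "\<forall>u\<in>M - LM. \<exists>wa. fst wa \<in> W \<and> monom_degree (snd wa) = k \<and> g u = fst wa * xpow (snd wa)"
  proof
    fix u assume "u \<in> M - LM"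
    then have "g u \<in> monomial_multiples W k" using bij_betwE[OF g] B(2) by blast
    then show "\<exists>wa. fst wa \<in> W \<and> monom_degree (snd wa) = k \<and> g u = fst wa * xpow (snd wa)"
      by (force simp: monomial_multiples_def)
  qed
  then obtain wa where wa: "\<forall>u\<in>M - LM. fst (wa u) \<in> W \<and> monom_degree (snd (wa u)) = k
      \<and> g u = fst (wa u) * xpow (snd (wa u))"
    by (rule bchoice[THEN exE])
  define r where "r u = (if u \<in> LM then xpow u else g u)" for u
  have bij_r: "bij_betw r M B"
  proof -
    have "bij_betw r (M \<inter> LM) S0"
      unfolding S0_def by (rule bij_betw_imageI) (auto simp: r_def inj_on_def xpow_eq_iff)
    moreover have "bij_betw r (M - LM) (B - S0)"
      using g by (subst bij_betw_cong[of _ r g]) (auto simp: r_def)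
    ultimately have "bij_betw r ((M \<inter> LM) \<union> (M - LM)) (S0 \<union> (B - S0))"
      by (rule bij_betw_combine) blast
    moreover have "(M \<inter> LM) \<union> (M - LM) = M" "S0 \<union> (B - S0) = B" using B(1) by auto
    ultimately show ?thesis by simp
  qed
  have hom_r: "homog (Suc k) (r u)" if "u \<in> M" for u
    using homB bij_betwE[OF bij_r] that by blast
  obtain e where e: "bij_betw e {0..<N} M"
    using ex_bij_betw_nat_finite[OF finM] unfolding N_def by blast
  then have e: "bij_betw e {..<N} M" by (simp only: lessThan_atLeast0)
  have eM: "e i \<in> M" if "i < N" for i using bij_betwE[OF e] that by blast
  have e_inj: "i = j" if "i < N" "j < N" "e i = e j" for i j
    using bij_betw_imp_inj_on[OF e] that by (auto simp: inj_on_def)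
  have eq_if: "p = q" if "homog (Suc k) p" "homog (Suc k) q"
    "\<And>j. j < N \<Longrightarrow> Poly_Mapping.lookup p (e j) = Poly_Mapping.lookup q (e j)" for p q :: "('n, 'k) mpoly"
  proof (rule poly_mapping_eqI)
    fix s
    show "Poly_Mapping.lookup p s = Poly_Mapping.lookup q s"
    proof (cases "s \<in> M")
      case True
      then obtain j where "j < N" "s = e j" using bij_betw_imp_surj_on[OF e] by blast
      then show ?thesis using that(3) by simp
    next
      case False
      then show ?thesis using that(1,2) by (simp add: homog_altdef M_def)
    qed
  qed
  define S where "S = {i. i < N \<and> e i \<in> LM}"
  define c where "c i j = Poly_Mapping.lookup (r (e i)) (e j)" for i j
  have "\<forall>s\<in>LM. \<exists>f. f \<in> I \<and> homog (monom_degree s) f \<and> Poly_Mapping.lookup f s = 1 \<and>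
    (\<forall>t\<in>Poly_Mapping.keys f. (t, s) \<in> \<tau>)"
    using homogeneous_monic_leading[OF I] unfolding LM_def by blast
  then obtain F where F: "\<forall>s\<in>LM. F s \<in> I \<and> homog (monom_degree s) (F s) \<and> Poly_Mapping.lookup (F s) s = 1 \<and>
    (\<forall>t\<in>Poly_Mapping.keys (F s). (t, s) \<in> \<tau>)"
    by (rule bchoice[THEN exE])
  define f where "f i j = Poly_Mapping.lookup (F (e i)) (e j)" for i j
  define m where "m j = Poly_Mapping.lookup (e j)" for j
  \<comment> \<open>The coefficient matrix of the basis \<open>B\<close>.\<close>
  have det0: "det (mat N N (\<lambda>(i, j). if i \<in> S then (if i = j then 1 else 0) else c i j)) \<noteq> 0"
  proof (rule det_nonzero_if_rows_independent)
    fix d :: "nat \<Rightarrow> 'k"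
    assume "(\<Sum>i<N. d i * (if i \<in> S then (if i = j then 1 else 0) else c i j)) = 0" if "j < N" for j
    moreover have "(if i \<in> S then (if i = j then 1 else 0) else c i j) = c i j" if "i < N" "j < N" for i j
      using that e_inj[of i j] by (auto simp: S_def c_def r_def lookup_single when_def)
    ultimately have d: "(\<Sum>i<N. d i * c i j) = 0" if "j < N" for j
      using that by simp
    have "(\<Sum>i<N. cmul (d i) (r (e i))) = 0"
    proof (rule eq_if)
      show "homog (Suc k) (\<Sum>i<N. cmul (d i) (r (e i)))"
        using hom_r eM by (intro homog_sum homog_cmul) simp
    qed (use d in \<open>simp_all add: lookup_sum c_def\<close>)
    moreover have bij: "bij_betw (\<lambda>i. r (e i)) {..<N} B"
      using bij_betw_trans[OF e bij_r] by (simp add: comp_def)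
    define D where "D b = d (inv_into {..<N} (\<lambda>i. r (e i)) b)" for b
    have D: "D (r (e i)) = d i" if "i < N" for i
      using bij_betw_inv_into_left[OF bij] that by (simp add: D_def)
    have "(\<Sum>b\<in>B. cmul (D b) b) = (\<Sum>i<N. cmul (D (r (e i))) (r (e i)))"
      by (rule sum.reindex_bij_betw[OF bij, symmetric])
    ultimately have "(\<Sum>b\<in>B. cmul (D b) b) = 0" using D by simp
    then have "D b = 0" if "b \<in> B" for b
      using kv.independentD[OF B(3) finB order_refl _ that, of D] by simp
    then show "\<forall>i<N. d i = 0" using D bij_betwE[OF bij] by force
  qed
  have key: "\<forall>i\<in>S. p i = i"
    if p: "p permutes {..<N}" and fp: "\<And>i. i \<in> S \<Longrightarrow> f i (p i) \<noteq> 0"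
      and sums: "\<And>x. (\<Sum>i\<in>{..<N} - S. m (p i) x) = (\<Sum>i\<in>{..<N} - S. m i x)" for p
  proof -
    have SN: "S \<subseteq> {..<N}" "finite S" by (auto simp: S_def)
    have pN: "p i < N" if "i < N" for i using permutes_in_image[OF p, of i] that by simp
    have "(e (p i), e i) \<in> \<tau>" if "i \<in> S" for i
      using F fp[OF that] that by (auto simp: S_def f_def in_keys_iff)
    then have rigid: "(\<Sum>i\<in>S. e (p i)) = (\<Sum>i\<in>S. e i) \<longrightarrow> (\<forall>i\<in>S. e (p i) = e i)"
      by (rule conjunct2[OF term_order_sum_rigid[OF \<tau> SN(2)]])
    have "(\<Sum>i\<in>S. e (p i)) = (\<Sum>i\<in>S. e i)"
    proof (rule poly_mapping_eqI)
      fix x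
      have "(\<Sum>i<N. m (p i) x) = (\<Sum>i<N. m i x)"
        using sum.permute[OF p, of "\<lambda>i. m i x"] by (simp add: comp_def)
      moreover have "(\<Sum>i<N. m (p i) x) = (\<Sum>i\<in>{..<N} - S. m (p i) x) + (\<Sum>i\<in>S. m (p i) x)"
        "(\<Sum>i<N. m i x) = (\<Sum>i\<in>{..<N} - S. m i x) + (\<Sum>i\<in>S. m i x)"
        by (rule sum.subset_diff[OF SN(1)], simp)+
      ultimately show "Poly_Mapping.lookup (\<Sum>i\<in>S. e (p i)) x = Poly_Mapping.lookup (\<Sum>i\<in>S. e i) x"
        using sums[of x] by (simp add: lookup_sum m_def)
    qed
    with rigid have eq: "e (p i) = e i" if "i \<in> S" for i using that by blast
    have "p i = i" if "i \<in> S" for i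
      using that by (intro e_inj pN eq) (simp_all add: S_def)
    then show ?thesis by blast
  qed
  have f1: "f i i = 1" if "i \<in> S" for i using F that by (auto simp: S_def f_def)
  have SN: "S \<subseteq> {..<N}" by (auto simp: S_def)
  obtain y where y: "det (mat N N (\<lambda>(i, j). if i \<in> S then f i j else c i j * (\<Prod>x\<in>UNIV. y x ^ m j x))) \<noteq> 0"
  proof (rule det_deformation[OF inf SN, of f m c])
    show "f i i = 1" if "i \<in> S" for i using that by (rule f1)
    show "\<forall>i\<in>S. p i = i" if "p permutes {..<N}" "\<And>i. i \<in> S \<Longrightarrow> f i (p i) \<noteq> 0"
      "\<And>x. (\<Sum>i\<in>{..<N} - S. m (p i) x) = (\<Sum>i\<in>{..<N} - S. m i x)" for p
      using that by (rule key)
    show "det (mat N N (\<lambda>(i, j). if i \<in> S then (if i = j then 1 else 0) else c i j)) \<noteq> 0"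
      by (rule det0)
  qed (rule that)
  define Q where "Q i = (if i \<in> S then F (e i) else torus_scale y (r (e i)))" for i
  have Qc: "(if i \<in> S then f i j else c i j * (\<Prod>x\<in>UNIV. y x ^ m j x)) = Poly_Mapping.lookup (Q i) (e j)" for i j
    by (simp add: Q_def f_def c_def m_def lookup_torus_scale mult.commute)
  define W' where "W' = torus_scale y ` W"
  have homQ: "homog (Suc k) (Q i)" if "i < N" for i
  proof (cases "i \<in> S")
    case True
    then have "homog (monom_degree (e i)) (F (e i))" using F by (auto simp: S_def)
    then show ?thesis using eM[OF that] True by (simp add: Q_def M_def)
  next
    case False
    then show ?thesis using hom_r[OF eM[OF that]] by (simp add: Q_def homog_torus_scale)
  qed
  have Q_in: "Q i \<in> idl.span (I \<union> W')" if "i < N" for i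
  proof (cases "i \<in> S")
    case True
    then show ?thesis using F by (intro idl.span_base) (auto simp: Q_def S_def)
  next
    case False
    then have "e i \<in> M - LM" using that eM by (auto simp: S_def)
    then obtain w a where w: "w \<in> W" "r (e i) = w * xpow a" using wa by (auto simp: r_def)
    have "torus_scale y w \<in> idl.span (I \<union> W')" using w by (intro idl.span_base) (auto simp: W'_def)
    then have "Poly_Mapping.single 0 (\<Prod>x\<in>UNIV. y x ^ Poly_Mapping.lookup a x) * (xpow a * torus_scale y w)
        \<in> idl.span (I \<union> W')" by (intro idl.span_scale)
    then show ?thesis using False by (simp only: Q_def w(2) torus_scale_mult_xpow if_False mult.commute)
  qed
  have "lin_reduces I W' k"
    unfolding lin_reduces_def
  proof (intro allI impI)
    fix s :: "'n monom" assume "monom_degree s = Suc k"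
    then have "s \<in> M" by (simp add: M_def)
    then obtain l where l: "l < N" "s = e l" using bij_betw_imp_surj_on[OF e] by blast
    have "det (mat N N (\<lambda>(i, j). Poly_Mapping.lookup (Q i) (e j))) \<noteq> 0" using y unfolding Qc .
    from unit_vectors_in_row_space[OF this l(1)] obtain d where
      d: "\<And>j. j < N \<Longrightarrow> (\<Sum>i<N. d i * Poly_Mapping.lookup (Q i) (e j)) = (if j = l then 1 else 0)" by blast
    have "xpow s = (\<Sum>i<N. cmul (d i) (Q i))"
    proof (rule eq_if)
      show "homog (Suc k) (xpow s :: ('n, 'k) mpoly)" using \<open>s \<in> M\<close> by (simp add: M_def)
      show "homog (Suc k) (\<Sum>i<N. cmul (d i) (Q i))" using homQ by (intro homog_sum homog_cmul) simp
      show "Poly_Mapping.lookup (xpow s) (e j) = Poly_Mapping.lookup (\<Sum>i<N. cmul (d i) (Q i)) (e j)"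
        if "j < N" for j
        using d[OF that] e_inj[OF that l(1)] by (auto simp: lookup_sum l(2) lookup_single when_def)
    qed
    moreover have "(\<Sum>i<N. cmul (d i) (Q i)) \<in> idl.span (I \<union> W')"
      using Q_in by (intro idl.span_sum idl.span_scale) simp
    ultimately show "(xpow s :: ('n, 'k) mpoly) \<in> idl.span (I \<union> W')" by simp
  qed
  then show thesis
    using W(2) homog_torus_scale card_image_le[OF W(1)] W(1)
    by (intro that[of W']) (auto simp: W'_def)
qed

section \<open>The inequality of reduction numbers\<close>

text \<open>
  Needed because the least element of an empty set of exponents would be an unspecified number.
\<close>

lemma exists_minimal_reduction:
  fixes I :: "('n::finite, 'k::field) mpoly set"
  assumes I: "homogeneous_ideal I" and I1: "I \<subseteq> tail_ideal 1"
  shows "\<exists>k L. is_minimal_reduction I L \<and> reduces_at I L k"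
proof -
  let ?P = "\<lambda>W. finite W \<and> (\<forall>w\<in>W. homog 1 w) \<and> (\<exists>k. lin_reduces I W k)"
  let ?V = "xpow ` {s. monom_degree s = 1} :: ('n, 'k) mpoly set"
  have "lin_reduces I ?V 0" by (auto simp: lin_reduces_def intro: idl.span_base)
  moreover have "finite ?V" using finite_monom_degree_eq by auto
  ultimately have "?P ?V" by auto
  then obtain W where W: "?P W" "\<And>W'. ?P W' \<Longrightarrow> card W \<le> card W'"
    using ex_has_least_nat[of ?P ?V card] by blast
  then obtain k where k: "lin_reduces I W k" by blast
  have "\<forall>W' k'. finite W' \<and> (\<forall>w\<in>W'. homog 1 w) \<and> lin_reduces I W' k' \<longrightarrow> card W \<le> card W'"
    using W(2) by blast
  from lin_reduces_imp_minimal_reduction[OF I I1 _ _ k this] show ?thesis using W(1) by blast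
qed

theorem mainTheorem2:
  fixes I :: "('n::finite, 'k::field) mpoly set"
    and \<tau> :: "'n monom rel"
  assumes "infinite (UNIV :: 'k set)"
    and "homogeneous_ideal I"
    and "I \<noteq> UNIV"
    and "term_order \<tau>"
  shows "quot_reduction_number I \<le> quot_reduction_number (initial_ideal \<tau> I)"
proof -
  note inf = assms(1) and I = assms(2) and \<tau> = assms(4)
  note I' = homogeneous_idealD(1)[OF I]
  have I1: "I \<subseteq> tail_ideal 1" by (rule proper_homogeneous_ideal_subset[OF I assms(3)])
  define U where "U = initial_ideal \<tau> I"
  have U: "homogeneous_ideal U" "U \<subseteq> tail_ideal 1"
    unfolding U_def by (rule homogeneous_initial_ideal[OF \<tau> I'], rule initial_ideal_subset[OF \<tau> I' I1])
  note U' = homogeneous_idealD(1)[OF U(1)]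
  interpret A: proper_poly_quotient I by unfold_locales (use I' I1 in auto)
  interpret B: proper_poly_quotient U by unfold_locales (use U' U in auto)
  define k where "k = quot_reduction_number U"
  have "\<exists>L. is_minimal_reduction U L \<and> reduces_at U L k"
    unfolding k_def B.quot_reduction_number_eq
    by (rule LeastI_ex) (rule exists_minimal_reduction[OF U])
  then obtain L where L: "is_minimal_reduction U L" "reduces_at U L k" by blast
  obtain W where "finite W" "\<forall>w\<in>W. homog 1 w" and W3: "lin_reduces U W k"
    and W_min: "\<forall>W' k'. finite W' \<and> W' \<subseteq> kv.span W \<and> lin_reduces U W' k' \<longrightarrow> card W \<le> card W'"
    using minimal_reduction_imp_lin_reduces[OF U L] by blast
  then have W: "finite W" "\<And>w. w \<in> W \<Longrightarrow> homog 1 w" by blast+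
  have "lin_reduces (initial_ideal \<tau> I) W k" using W3 by (simp only: U_def)
  then obtain W' where W'lin: "\<forall>w\<in>W'. homog 1 w"
    and W': "finite W'" "card W' \<le> card W" "lin_reduces I W' k"
    using lin_reduces_deformation[OF inf \<tau> I W] by blast
  have ind: "\<forall>\<alpha>\<in>(\<Pi>\<^sub>E w\<in>W. {..N}). d \<alpha> = 0"
    if rel: "(\<Sum>\<alpha>\<in>(\<Pi>\<^sub>E w\<in>W. {..N}). cmul (d \<alpha>) (\<Prod>w\<in>W. w ^ \<alpha> w)) \<in> U" for N d
  proof (rule ccontr)
    assume "\<not> ?thesis"
    then obtain \<alpha>0 where \<alpha>0: "\<alpha>0 \<in> (\<Pi>\<^sub>E w\<in>W. {..N})" "d \<alpha>0 \<noteq> 0" by blast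
    have "finite (\<Pi>\<^sub>E w\<in>W. {..N})" using W(1) by (intro finite_PiE) auto
    moreover have "(\<Pi>\<^sub>E w\<in>W. {..N}) \<subseteq> extensional W" by (auto simp: PiE_def)
    ultimately show False
      using algebraic_relation_imp_smaller[OF inf U W W3 _ _ rel \<alpha>0] W_min
      by (meson linorder_not_less)
  qed
  \<comment> \<open>A nonzero element of \<open>I\<close> has a leading monomial, so it is not a combination of monomials outside the initial ideal.\<close>
  have std: "\<forall>s\<in>T. d s = 0"
    if T: "finite T" "T \<subseteq> - leading_monoms \<tau> I" and rel: "(\<Sum>s\<in>T. cmul (d s) (xpow s)) \<in> I" for T d
  proof (rule ccontr)
    assume ne: "\<not> ?thesis"
    let ?p = "\<Sum>s\<in>T. cmul (d s) (xpow s)"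
    have lookup_p: "Poly_Mapping.lookup ?p s = (if s \<in> T then d s else 0)" for s
      using T(1) by (simp add: lookup_sum lookup_single when_def if_distrib[of "(*) _"] cong: if_cong)
    obtain s0 where "s0 \<in> T" "d s0 \<noteq> 0" using ne by blast
    then have "s0 \<in> Poly_Mapping.keys ?p" using lookup_p[of s0] by (simp only: in_keys_iff if_True not_False_eq_True)
    then have "Poly_Mapping.keys ?p \<noteq> {}" by blast
    then obtain s where s: "s \<in> Poly_Mapping.keys ?p" "\<forall>t\<in>Poly_Mapping.keys ?p. (t, s) \<in> \<tau>"
      using term_order_finite_max[OF \<tau> finite_keys] by blast
    then have "?p \<noteq> 0" by (metis empty_iff keys_zero)
    with rel s have "s \<in> leading_monoms \<tau> I"
      unfolding leading_monoms_def is_leading_monom_def by blast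
    moreover have "s \<in> T" using s(1) lookup_p[of s] by (auto simp: in_keys_iff split: if_splits)
    ultimately show False using T(2) by blast
  qed
  have "card W \<le> card W''"
    if W'': "finite W''" "\<And>w. w \<in> W'' \<Longrightarrow> homog 1 w" "lin_reduces I W'' k''" for W'' k''
  proof (rule card_independent_le_card_generators[OF I W'' std])
    show "kv.subspace U" by (rule subspace_idl_imp_kv[OF U'])
    show "xpow s \<in> U" if "s \<notin> - leading_monoms \<tau> I" for s
      using that by (simp add: U_def mem_initial_ideal_iff[OF \<tau> I'])
  qed (use W ind in auto)
  then have "\<forall>W'' k''. finite W'' \<and> (\<forall>w\<in>W''. homog 1 w) \<and> lin_reduces I W'' k'' \<longrightarrow> card W' \<le> card W''"
    using W'(2) by (meson order_trans)
  note lin_reduces_imp_minimal_reduction[OF I I1 W'(1) W'lin W'(3) this]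
  then have "\<exists>L. is_minimal_reduction I L \<and> reduces_at I L k" by blast
  then have "quot_reduction_number I \<le> k"
    unfolding A.quot_reduction_number_eq by (rule Least_le)
  then show ?thesis by (simp add: k_def U_def)
qed

end
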